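(* Let $n\ge2$ and $G=\mathrm{SU}(n)$, and let $\mu_n\subset\mathbb T$ be the group of $n$-th roots of unity. With the identifications $Z(\mathrm{SU}(n))=\mu_n$ and $H^3(P/Q;\mathbb T)=\mu_n$ described in the context, the homomorphism $\Theta\colon Z(\mathrm{SU}(n))^{n-1}=\mu_n^{n-1}\to H^3(P/Q;\mathbb T)=\mu_n$ is given by $$\Theta(\tau)=\prod_{i=1}^{n-1}\tau_i^{-i},\qquad \tau=(\tau_1,\dots,\tau_{n-1})\in\mu_n^{n-1}.$$
   Context: $T\subset\mathrm{SU}(n)$ is the diagonal torus, $T\subset\mathbb T^n$; the weight lattice $P=\hat T$ is generated by $L_1,\dots,L_n$ with $\sum_iL_i=0$ and pairing $\langle t,L_i\rangle=t_i$. Simple roots: $\alpha_i=L_i-L_{i+1}$, $1\le i\le n-1$; $Q$ is the root lattice they generate. $Z(\mathrm{SU}(n))$ (scalar matrices) is identified with $\mu_n$. The homomorphism $|\cdot|\colon P\to\mathbb Z$, $L_1\mapsto n-1$, $L_i\mapsto-1$ for $1<i\le n$, maps $Q$ onto $n\mathbb Z$ and identifies $P/Q$ with $\mathbb Z/n\mathbb Z$. The group $H^3(\mathbb Z/n\mathbb Z;\mathbb T)$ is cyclic of order $n$ and is identified with $\mu_n$ by letting $\zeta\in\mu_n$ correspond to the class of the cocycle $(a,b,c)\mapsto\zeta^{\omega_n(a,b)c}$, where $\omega_n(a,b)=\lfloor\frac{a+b}n\rfloor-\lfloor\frac an\rfloor-\lfloor\frac bn\rfloor$. Definition of $\Theta$.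 For $\tau=(\tau_1,\dots,\tau_{n-1})\in Z(\mathrm{SU}(n))^{n-1}$ choose $f\colon P\times P\to\mathbb T$ with $f(\lambda,\mu+\alpha)=f(\lambda,\mu)$ for $\alpha\in Q$ and $f(\lambda+\alpha_i,\mu)=\langle\tau_i,\mu\rangle f(\lambda,\mu)$. Then $(\partial f)(\lambda,\mu,\nu)=f(\mu,\nu)f(\lambda+\mu,\nu)^{-1}f(\lambda,\mu+\nu)f(\lambda,\mu)^{-1}$ descends to a $3$-cocycle on $P/Q$, $\Phi^\tau=\overline{\partial f}$, and $\Theta(\tau)\in H^3(P/Q;\mathbb T)$ is the class of $\Phi^\tau$ (independent of the choice of $f$).
   Formalization: The centre is identified with μ_n by letting ζ correspond to the scalar matrix ζ^{-1}·1 (so ζ pairs with a weight λ as ζ^{|λ|}); if scalar matrices ζ·1 correspond to ζ, the exponents in the formula are +i instead of -i, and the printed formula fails for n ≥ 3. *)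

theory Defs
  imports
    "HOL-Analysis.Function_Topology"
    "HOL-Algebra.Elementary_Groups"
    "HOL-Algebra.Product_Groups"
    "HOL-Algebra.Generated_Groups"
    "Jordan_Normal_Form.Schur_Decomposition"
begin

section \<open>The circle group, \<open>SU(n)\<close>, its centre and its diagonal torus\<close>

definition circle_group :: "complex monoid"
  where "circle_group = \<lparr>carrier = {z. cmod z = 1}, monoid.mult = (*), one = 1\<rparr>"

definition SU :: "nat \<Rightarrow> complex mat monoid"
  where "SU n = \<lparr>carrier = {A \<in> carrier_mat n n. mat_adjoint A * A = 1\<^sub>m n \<and> det A = 1},
                 monoid.mult = (*), one = 1\<^sub>m n\<rparr>"

definition group_center :: "('a, 'b) monoid_scheme \<Rightarrow> ('a, 'b) monoid_scheme"
  where "group_center G =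
    G\<lparr>carrier := {z \<in> carrier G. \<forall>g\<in>carrier G. z \<otimes>\<^bsub>G\<^esub> g = g \<otimes>\<^bsub>G\<^esub> z}\<rparr>"

text \<open>Matrix indices start at 0, the coordinates of the \<open>n\<close>-torus at 1.\<close>

definition diag_entries :: "nat \<Rightarrow> complex mat \<Rightarrow> (nat \<Rightarrow> complex)"
  where "diag_entries n A = (\<lambda>i\<in>{1..n}. A $$ (i - 1, i - 1))"

definition torus :: "nat \<Rightarrow> (nat \<Rightarrow> complex) monoid"
  where "torus n = (product_group {1..n} (\<lambda>_. circle_group))
    \<lparr>carrier := diag_entries n ` {A \<in> carrier (SU n). diagonal_mat A}\<rparr>"


section \<open>Weight lattice and root lattice\<close>

text \<open>
  The weight lattice is the Pontryagin dual of the torus: the group of continuous homomorphisms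
  to the circle. It is written multiplicatively here, and the pairing of \<open>t\<close> with a weight \<open>l\<close>
  is the value \<open>l t\<close>.
\<close>

definition weight_lattice :: "nat \<Rightarrow> ((nat \<Rightarrow> complex) \<Rightarrow> complex) monoid"
  where "weight_lattice n = (product_group (carrier (torus n)) (\<lambda>_. circle_group))
    \<lparr>carrier := {l \<in> extensional (carrier (torus n)).
        l \<in> hom (torus n) circle_group \<and> continuous_on (carrier (torus n)) l}\<rparr>"

definition fund_weight :: "nat \<Rightarrow> nat \<Rightarrow> (nat \<Rightarrow> complex) \<Rightarrow> complex"
  where "fund_weight n i = (\<lambda>t\<in>carrier (torus n). t i)"

definition simple_root :: "nat \<Rightarrow> nat \<Rightarrow> (nat \<Rightarrow> complex) \<Rightarrow> complex"
  where "simple_root n i =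
    fund_weight n i \<otimes>\<^bsub>weight_lattice n\<^esub> inv\<^bsub>weight_lattice n\<^esub> (fund_weight n (i + 1))"

definition root_lattice :: "nat \<Rightarrow> ((nat \<Rightarrow> complex) \<Rightarrow> complex) set"
  where "root_lattice n = generate (weight_lattice n) (simple_root n ` {1..n - 1})"

abbreviation PQ :: "nat \<Rightarrow> ((nat \<Rightarrow> complex) \<Rightarrow> complex) set monoid"
  where "PQ n \<equiv> weight_lattice n Mod root_lattice n"

definition weight_degree :: "nat \<Rightarrow> ((nat \<Rightarrow> complex) \<Rightarrow> complex) \<Rightarrow> int"
  where "weight_degree n = (THE h.
    h \<in> extensional (carrier (weight_lattice n)) \<and> h \<in> hom (weight_lattice n) integer_group \<and>
    h (fund_weight n 1) = int n - 1 \<and> (\<forall>i\<in>{2..n}. h (fund_weight n i) = - 1))"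

text \<open>
  The induced isomorphism from \<open>PQ n\<close> onto \<open>integer_mod_group n\<close>, whose carrier is
  \<open>{0..<n}\<close>; the degree modulo \<open>n\<close> is constant on each coset.
\<close>

definition coset_degree :: "nat \<Rightarrow> ((nat \<Rightarrow> complex) \<Rightarrow> complex) set \<Rightarrow> int"
  where "coset_degree n X = the_elem ((\<lambda>l. weight_degree n l mod int n) ` X)"


section \<open>Third cohomology with circle coefficients\<close>

text \<open>Inhomogeneous cochains with trivial action, written multiplicatively.\<close>

definition cochains2 :: "('a, 'b) monoid_scheme \<Rightarrow> ('a \<times> 'a \<Rightarrow> complex) monoid"
  where "cochains2 G = product_group (carrier G \<times> carrier G) (\<lambda>_. circle_group)"

definition cochains3 :: "('a, 'b) monoid_scheme \<Rightarrow> ('a \<times> 'a \<times> 'a \<Rightarrow> complex) monoid"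
  where "cochains3 G = product_group (carrier G \<times> carrier G \<times> carrier G) (\<lambda>_. circle_group)"

definition coboundary2 ::
    "('a, 'b) monoid_scheme \<Rightarrow> ('a \<times> 'a \<Rightarrow> complex) \<Rightarrow> ('a \<times> 'a \<times> 'a \<Rightarrow> complex)"
  where "coboundary2 G f = (\<lambda>(x, y, z)\<in>carrier G \<times> carrier G \<times> carrier G.
    f (y, z) * inverse (f (x \<otimes>\<^bsub>G\<^esub> y, z)) * f (x, y \<otimes>\<^bsub>G\<^esub> z) * inverse (f (x, y)))"

definition cocycles3 :: "('a, 'b) monoid_scheme \<Rightarrow> ('a \<times> 'a \<times> 'a \<Rightarrow> complex) monoid"
  where "cocycles3 G = (cochains3 G)\<lparr>carrier := {F \<in> carrier (cochains3 G).
    \<forall>x\<in>carrier G. \<forall>y\<in>carrier G. \<forall>z\<in>carrier G. \<forall>w\<in>carrier G.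
      F (y, z, w) * inverse (F (x \<otimes>\<^bsub>G\<^esub> y, z, w)) * F (x, y \<otimes>\<^bsub>G\<^esub> z, w)
        * inverse (F (x, y, z \<otimes>\<^bsub>G\<^esub> w)) * F (x, y, z) = 1}\<rparr>"

definition coboundaries3 :: "('a, 'b) monoid_scheme \<Rightarrow> ('a \<times> 'a \<times> 'a \<Rightarrow> complex) set"
  where "coboundaries3 G = coboundary2 G ` carrier (cochains2 G)"

definition H3 :: "('a, 'b) monoid_scheme \<Rightarrow> ('a \<times> 'a \<times> 'a \<Rightarrow> complex) set monoid"
  where "H3 G = cocycles3 G Mod coboundaries3 G"

definition H3_class ::
    "('a, 'b) monoid_scheme \<Rightarrow> ('a \<times> 'a \<times> 'a \<Rightarrow> complex) \<Rightarrow> ('a \<times> 'a \<times> 'a \<Rightarrow> complex) set"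
  where "H3_class G F = coboundaries3 G #>\<^bsub>cocycles3 G\<^esub> F"


section \<open>The identifications with the \<open>n\<close>-th roots of unity\<close>

definition omega :: "nat \<Rightarrow> int \<Rightarrow> int \<Rightarrow> int"
  where "omega n a b = (a + b) div int n - a div int n - b div int n"

definition H3_of_root ::
    "nat \<Rightarrow> complex \<Rightarrow> (((nat \<Rightarrow> complex) \<Rightarrow> complex) set \<times> ((nat \<Rightarrow> complex) \<Rightarrow> complex) set \<times>
      ((nat \<Rightarrow> complex) \<Rightarrow> complex) set \<Rightarrow> complex) set"
  where "H3_of_root n \<zeta> = H3_class (PQ n)
    (\<lambda>(X, Y, Z)\<in>carrier (PQ n) \<times> carrier (PQ n) \<times> carrier (PQ n).
      \<zeta> powi (omega n (coset_degree n X) (coset_degree n Y) * coset_degree n Z))"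

text \<open>
  The centre of \<open>SU n\<close> is the group of characters of \<open>PQ n\<close>, which the degree map identifies
  with the integers modulo \<open>n\<close>; a central element thus corresponds to the root of unity \<open>\<zeta>\<close>
  through which it pairs with each weight \<open>l\<close> as \<open>\<zeta>\<close> to the power of the degree of \<open>l\<close>. As every
  fundamental weight has degree \<open>-1\<close> modulo \<open>n\<close>, \<open>\<zeta>\<close> is the inverse of the scalar by which the
  central matrix acts. This is the normalisation for which the formula for \<open>\<Theta>\<close> has exponents
  \<open>-i\<close>: with the scalar itself in place of \<open>\<zeta>\<close> the exponents would be \<open>i\<close>.
\<close>

definition root_of_center :: "nat \<Rightarrow> complex mat \<Rightarrow> complex"
  where "root_of_center n z = (THE \<zeta>. \<zeta> ^ n = 1 \<and>
    (\<forall>l\<in>carrier (weight_lattice n). l (diag_entries n z) = \<zeta> powi weight_degree n l))"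


section \<open>The map \<open>\<Theta>\<close>\<close>

text \<open>Tuples of central elements are extensional functions on \<open>{1..n - 1}\<close>.\<close>

abbreviation center_tuples :: "nat \<Rightarrow> (nat \<Rightarrow> complex mat) monoid"
  where "center_tuples n \<equiv> product_group {1..n - 1} (\<lambda>_. group_center (SU n))"

definition Theta_cochains ::
    "nat \<Rightarrow> (nat \<Rightarrow> complex mat) \<Rightarrow>
      (((nat \<Rightarrow> complex) \<Rightarrow> complex) \<times> ((nat \<Rightarrow> complex) \<Rightarrow> complex) \<Rightarrow> complex) set"
  where "Theta_cochains n \<tau> = {f \<in> carrier (cochains2 (weight_lattice n)).
    (\<forall>l\<in>carrier (weight_lattice n). \<forall>m\<in>carrier (weight_lattice n). \<forall>a\<in>root_lattice n.
      f (l, m \<otimes>\<^bsub>weight_lattice n\<^esub> a) = f (l, m)) \<and>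
    (\<forall>l\<in>carrier (weight_lattice n). \<forall>m\<in>carrier (weight_lattice n). \<forall>i\<in>{1..n - 1}.
      f (l \<otimes>\<^bsub>weight_lattice n\<^esub> simple_root n i, m) = m (diag_entries n (\<tau> i)) * f (l, m))}"

text \<open>
  \<open>descend3 G N F\<close> is the map on the quotient induced by \<open>F\<close>; it is only meaningful if \<open>F\<close> is
  constant on products of cosets.
\<close>

definition descend3 ::
    "('a, 'b) monoid_scheme \<Rightarrow> 'a set \<Rightarrow> ('a \<times> 'a \<times> 'a \<Rightarrow> complex) \<Rightarrow>
      ('a set \<times> 'a set \<times> 'a set \<Rightarrow> complex)"
  where "descend3 G N F =
    (\<lambda>(X, Y, Z)\<in>carrier (G Mod N) \<times> carrier (G Mod N) \<times> carrier (G Mod N).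
      the_elem (F ` (X \<times> Y \<times> Z)))"

text \<open>The definite description amounts to existence of \<open>f\<close> and independence of its choice.\<close>

definition Theta ::
    "nat \<Rightarrow> (nat \<Rightarrow> complex mat) \<Rightarrow>
      (((nat \<Rightarrow> complex) \<Rightarrow> complex) set \<times> ((nat \<Rightarrow> complex) \<Rightarrow> complex) set \<times>
        ((nat \<Rightarrow> complex) \<Rightarrow> complex) set \<Rightarrow> complex) set"
  where "Theta n \<tau> = (THE c. \<exists>f\<in>Theta_cochains n \<tau>.
    c = H3_class (PQ n) (descend3 (weight_lattice n) (root_lattice n)
          (coboundary2 (weight_lattice n) f)))"

end

theory Submission
  imports Defs "HOL-Analysis.Further_Topology"
begin

text \<open>
  Every weight is \<open>t \<mapsto> \<Prod>i<n. t\<^sub>i^k\<^sub>i\<close> for a unique integer vector \<open>k\<close>, because a continuous character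
  of the circle is a power map. In terms of \<open>k\<close> the coefficient of \<open>\<alpha>\<^sub>i\<close> in a weight \<open>\<lambda>\<close> can be rounded
  to the integer \<open>c\<^sub>i(\<lambda>) = k\<^sub>1 + \<dots> + k\<^sub>i + i(\<lfloor>|\<lambda>|/n\<rfloor> - k\<^sub>1)\<close>, which increases by one when \<open>\<alpha>\<^sub>i\<close> is
  added and is additive up to \<open>i \<omega>\<^sub>n(|\<lambda>|, |\<mu>|)\<close>. If \<open>\<tau>\<^sub>i\<close> corresponds to \<open>\<zeta>\<^sub>i\<close>, then
  \<open>f(\<lambda>, \<mu>) = \<Prod>i. \<zeta>\<^sub>i^(c\<^sub>i(\<lambda>) |\<mu>|)\<close> is an admissible choice, and its coboundary is
  exactly \<open>(\<Prod>i. \<zeta>\<^sub>i^(-i))^(\<omega>\<^sub>n(|\<lambda>|, |\<mu>|) |\<nu>|)\<close>.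
\<close>

text \<open>If the coefficients \<open>c_i\<close> were additive, \<open>f\<close> would be a
  bicharacter, and the coboundary of a bicharacter is trivial. So the class measures how far
  integral root coefficients are from being additive. The true coefficients are additive but lie in
  \<open>(1/n) Z\<close>, and a root of unity has no canonical fractional power, so some rounding is
  forced. In every \<open>c_i\<close> the only fractional contribution is \<open>i\<close> times the
  one number \<open>|\<lambda>|/n\<close>; rounding that number down gives the same defect
  \<open>omega\<close> for all \<open>i\<close>, with multiplicity \<open>i\<close>. Two further
  obstacles shape the proof. Weights are arbitrary continuous characters of the torus, so they must
  be classified before exponents can be used at all. And \<open>Theta\<close>,
  \<open>weight_degree\<close> and \<open>root_of_center\<close> are definite descriptions: an
  explicit candidate is not enough, every competitor has to be compared with it.\<close>

section \<open>Characters of the circle\<close>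

lemma additive_continuous_real:
  fixes h :: "real \<Rightarrow> complex"
  assumes cont: "continuous_on UNIV h" and add: "\<And>x y. h (x + y) = h x + h y"
  shows "h x = of_real x * h 1"
proof -
  have h0: "h 0 = 0" using add[of 0 0] by simp
  have nat: "h (of_nat k * y) = of_nat k * h y" for k y
    by (induction k) (simp_all add: h0 add distrib_right)
  have neg: "h (- y) = - h y" for y
    using add[of y "- y"] h0 by (simp add: eq_neg_iff_add_eq_0 add.commute)
  have int: "h (of_int k * y) = of_int k * h y" for k y
  proof (cases k)
    case (nonneg c)
    then show ?thesis using nat[of c y] by simp
  next
    case (neg c)
    have "of_int k * y = - (of_nat (Suc c) * y)" unfolding neg by (simp del: of_nat_Suc)
    then show ?thesis using nat[of "Suc c" y] \<open>\<And>y. h (- y) = - h y\<close> neg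
      by (simp del: of_nat_Suc)
  qed
  have rat: "h y = of_real y * h 1" if "y \<in> \<rat>" for y
  proof -
    obtain a b where b: "b > 0" and y: "y = of_int a / of_int b"
      using \<open>y \<in> \<rat>\<close> by (elim Rats_cases') auto
    have "of_int b * h y = of_int a * h 1"
      using int[of b y] int[of a 1] b by (simp add: y)
    then show ?thesis using b by (simp add: y field_simps)
  qed
  \<comment> \<open>Additivity alone gives linearity over the rationals; continuity extends it to
    their closure, the whole line.\<close>
  have cont': "continuous_on (closure \<rat>) (\<lambda>x. h x - of_real x * h 1)"
    unfolding Rats_closure_real by (intro continuous_intros cont)
  have "h x - of_real x * h 1 = 0"
  proof (rule continuous_constant_on_closure[OF cont'])
    fix y :: real assume "y \<in> \<rat>"
    from rat[OF this] show "h y - of_real y * h 1 = 0" by (rule right_minus_eq[THEN iffD2])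
  qed (simp add: Rats_closure_real)
  then show ?thesis by simp
qed

text \<open>The line is contractible, so \<open>g\<close> has a continuous logarithm. Normalised to
  vanish at 0 it is additive, hence linear, and the period condition forces its slope to be
  \<open>\<i>\<close> times an integer.\<close>

lemma circle_character:
  fixes g :: "real \<Rightarrow> complex"
  assumes cont: "continuous_on UNIV g" and mult: "\<And>x y. g (x + y) = g x * g y"
    and period: "g (2 * pi) = 1"
  obtains k :: int where "\<And>x. g x = cis x powi k"
proof -
  have g0: "g 0 = 1" using mult[of "2 * pi" 0] period by simp
  have nz: "g x \<noteq> 0" for x using mult[of x "- x"] g0 by auto
  obtain l where l: "continuous_on UNIV l" "\<And>x. g x = exp (l x)"
    using continuous_logarithm_on_contractible[OF cont] nz convex_imp_contractible convex_UNIV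
    by (metis UNIV_I)
  define h where "h x = l x - l 0" for x
  have hc: "continuous_on UNIV h" unfolding h_def by (intro continuous_intros l)
  have gh: "g x = exp (h x)" for x
    using l(2)[of x] l(2)[of 0] g0 by (simp add: h_def exp_diff)
  have add: "h (x + y) = h x + h y" for x y
  proof -
    define d where "d x = h (x + y) - h x - h y" for x
    have e: "exp (d x) = 1" for x
      using mult[of x y] nz[of x] nz[of y] by (simp add: d_def exp_diff gh)
    have "d constant_on UNIV"
    proof (rule continuous_discrete_range_constant)
      show "continuous_on UNIV d" unfolding d_def
        by (intro continuous_intros hc continuous_on_compose2[OF hc]) auto
      fix x :: real
      \<comment> \<open>The additivity defect \<open>d\<close> takes values in the discrete set
        where \<open>exp\<close> is 1, so by continuity it is constant. Distinct values differ by at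
        least \<open>2 * pi\<close>; the bound 1 is merely a convenient smaller number.\<close>
      have "1 \<le> norm (d z - d x)" if "d z \<noteq> d x" for z
      proof (rule ccontr)
        assume "\<not> 1 \<le> norm (d z - d x)"
        then have "norm (d z - d x) < 1" by simp
        then have "\<bar>Im (d z) - Im (d x)\<bar> < 1"
          using abs_Im_le_cmod[of "d z - d x"] by simp
        then have "\<bar>Im (d z) - Im (d x)\<bar> < 2 * pi" using pi_gt3 by linarith
        then have "d z = d x" by (rule exp_complex_eqI) (simp_all add: e)
        with that show False by simp
      qed
      then show "\<exists>e>0. \<forall>z. z \<in> UNIV \<and> d z \<noteq> d x \<longrightarrow> e \<le> norm (d z - d x)"
        by (intro exI[of _ 1]) auto
    qed simp
    then have "d x = d 0" by (auto simp: constant_on_def)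
    then show ?thesis by (simp add: d_def h_def algebra_simps)
  qed
  note lin = additive_continuous_real[OF hc add]
  have "exp (h (2 * pi)) = 1" using period gh by simp
  then obtain k where k: "Re (h (2 * pi)) = 0" "Im (h (2 * pi)) = of_int (2 * k) * pi"
    by (auto simp: exp_eq_1)
  have h1: "h 1 = \<i> * of_int k"
    using k lin[of "2 * pi"] by (intro complex_eqI) (auto simp: field_simps)
  have "g x = cis (of_int k * x)" for x
    using lin[of x] by (simp add: gh h1 cis_conv_exp mult_ac)
  then have "g x = cis x powi k" for x by (simp add: cis_power_int)
  then show thesis by (rule that)
qed

text \<open>The index type may be infinite, but by \<open>cong\<close> a vector can be replaced by
  its truncation to \<open>I\<close>, a finite combination of unit vectors. This serves to show that
  the degree homomorphism is unique.\<close>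

lemma additive_on_int_vectors:
  fixes H :: "('i \<Rightarrow> int) \<Rightarrow> int"
  assumes fin: "finite I" and add: "\<And>k m. H (\<lambda>i. k i + m i) = H k + H m"
    and cong: "\<And>k m. (\<And>i. i \<in> I \<Longrightarrow> k i = m i) \<Longrightarrow> H k = H m"
  shows "H k = (\<Sum>i\<in>I. k i * H (\<lambda>j. of_bool (j = i)))"
proof -
  have H0: "H (\<lambda>_. 0) = 0" using add[of "\<lambda>_. 0" "\<lambda>_. 0"] by simp
  have nat: "H (\<lambda>j. int c * k j) = int c * H k" for c k
  proof (induction c)
    case (Suc c)
    then show ?case using add[of k "\<lambda>j. int c * k j"] by (simp add: distrib_right)
  qed (simp add: H0)
  have neg: "H (\<lambda>j. - k j) = - H k" for k
    using add[of k "\<lambda>j. - k j"] H0 by simp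
  have scale: "H (\<lambda>j. c * k j) = c * H k" for c k
  proof (cases c)
    case (neg d)
    have "(\<lambda>j. c * k j) = (\<lambda>j. int (Suc d) * - k j)" unfolding neg by (simp del: of_nat_Suc)
    then show ?thesis using nat[of "Suc d" "\<lambda>j. - k j"] \<open>\<And>k. H (\<lambda>j. - k j) = - H k\<close> neg
      by (simp del: of_nat_Suc)
  qed (simp add: nat)
  have "H (\<lambda>j. if j \<in> J then k j else 0) = (\<Sum>i\<in>J. k i * H (\<lambda>j. of_bool (j = i)))"
    if "finite J" for J
    using that
  proof (induction J)
    case (insert a J)
    have "(\<lambda>j. if j \<in> insert a J then k j else 0) =
        (\<lambda>j. k a * of_bool (j = a) + (if j \<in> J then k j else 0))"
      using insert.hyps by auto
    then show ?case using insert by (simp add: add scale)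
  qed (simp add: H0)
  from this[OF fin] cong[of "\<lambda>j. if j \<in> I then k j else 0" k] show ?thesis by simp
qed

section \<open>The torus and its weights\<close>

lemma circle_group_simps [simp]:
  "carrier circle_group = {z. cmod z = 1}" "x \<otimes>\<^bsub>circle_group\<^esub> y = x * y" "\<one>\<^bsub>circle_group\<^esub> = 1"
  by (simp_all add: circle_group_def)

lemma cmod_powi: "cmod z = 1 \<Longrightarrow> cmod (z powi k) = 1"
  by (simp add: norm_power_int)

section \<open>Special unitary matrices by entries, and coordinates on the diagonal torus\<close>

lemma index_mat_adjoint:
  "A \<in> carrier_mat n n \<Longrightarrow> i < n \<Longrightarrow> j < n \<Longrightarrow> mat_adjoint A $$ (i, j) = conjugate (A $$ (j, i))"
  by (simp add: mat_adjoint_def mat_of_rows_def)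

lemma mat_adjoint_carrier: "A \<in> carrier_mat n n \<Longrightarrow> mat_adjoint A \<in> carrier_mat n n"
  by (rule carrier_matI) (simp_all add: mat_adjoint_def)

text \<open>Orthonormality of the columns; in this form membership of explicit test matrices reduces
  to finite sums.\<close>

lemma SU_iff:
  assumes A: "A \<in> carrier_mat n n"
  shows "A \<in> carrier (SU n) \<longleftrightarrow>
    (\<forall>i<n. \<forall>j<n. (\<Sum>k<n. cnj (A $$ (k, i)) * A $$ (k, j)) = of_bool (i = j)) \<and> det A = 1"
proof -
  have "(mat_adjoint A * A) $$ (i, j) = (\<Sum>k<n. cnj (A $$ (k, i)) * A $$ (k, j))"
    if "i < n" "j < n" for i j
    using A mat_adjoint_carrier[OF A] that
    by (simp add: scalar_prod_def index_mat_adjoint[OF A] lessThan_atLeast0)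
  then have "mat_adjoint A * A = 1\<^sub>m n \<longleftrightarrow>
      (\<forall>i<n. \<forall>j<n. (\<Sum>k<n. cnj (A $$ (k, i)) * A $$ (k, j)) = of_bool (i = j))"
    using A mat_adjoint_carrier[OF A] by (auto simp: mat_eq_iff)
  then show ?thesis using A by (simp add: SU_def)
qed

lemma sum_diagonal:
  fixes A :: "complex mat"
  assumes "\<And>k j. k < n \<Longrightarrow> j < n \<Longrightarrow> k \<noteq> j \<Longrightarrow> A $$ (k, j) = 0" "i < n" "j < n"
  shows "(\<Sum>k<n. cnj (A $$ (k, i)) * A $$ (k, j)) = of_bool (i = j) * (cmod (A $$ (i, i)))\<^sup>2"
proof -
  have "(\<Sum>k<n. cnj (A $$ (k, i)) * A $$ (k, j)) =
      (\<Sum>k<n. if k = i then cnj (A $$ (i, i)) * A $$ (i, j) else 0)"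
    using assms by (intro sum.cong) auto
  also have "\<dots> = cnj (A $$ (i, i)) * A $$ (i, j)" using assms by simp
  also have "\<dots> = of_bool (i = j) * (cmod (A $$ (i, i)))\<^sup>2"
    using assms by (auto simp: complex_norm_square[unfolded of_real_power] mult.commute)
  finally show ?thesis .
qed

lemma det_diagonal:
  fixes A :: "complex mat"
  assumes "A \<in> carrier_mat n n" "\<And>k j. k < n \<Longrightarrow> j < n \<Longrightarrow> k \<noteq> j \<Longrightarrow> A $$ (k, j) = 0"
  shows "det A = (\<Prod>i<n. A $$ (i, i))"
  using det_lower_triangular[OF _ assms(1)] assms
  by (simp add: prod_list_diag_prod lessThan_atLeast0)

lemma diagonal_SU_iff:
  fixes A :: "complex mat"
  assumes "A \<in> carrier_mat n n" "\<And>k j. k < n \<Longrightarrow> j < n \<Longrightarrow> k \<noteq> j \<Longrightarrow> A $$ (k, j) = 0"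
  shows "A \<in> carrier (SU n) \<longleftrightarrow> (\<forall>i<n. cmod (A $$ (i, i)) = 1) \<and> (\<Prod>i<n. A $$ (i, i)) = 1"
proof -
  have "(complex_of_real r)\<^sup>2 = 1 \<longleftrightarrow> r = 1" if "r \<ge> 0" for r
    using that by (metis of_real_eq_1_iff of_real_power one_power2 power2_eq_imp_eq zero_le_one)
  moreover have "det A = (\<Prod>i<n. A $$ (i, i))" by (rule det_diagonal[OF assms])
  ultimately show ?thesis
    unfolding SU_iff[OF assms(1)] by (auto simp: sum_diagonal[OF assms(2)])
qed

lemma prod_shift: "(\<Prod>i<n. f (Suc i)) = (\<Prod>i=1..n. f i)" for f :: "nat \<Rightarrow> complex"
  using prod.shift_bounds_nat_ivl[of f 0 1 n] by (simp add: lessThan_atLeast0 atLeastLessThanSuc_atLeastAtMost)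

lemma carrier_torus:
  "carrier (torus n) =
    {t \<in> extensional {1..n}. (\<forall>i\<in>{1..n}. cmod (t i) = 1) \<and> (\<Prod>i=1..n. t i) = 1}" (is "_ = ?T")
proof -
  have "diag_entries n A \<in> ?T" if A: "A \<in> carrier (SU n)" "diagonal_mat A" for A
  proof -
    have A': "A \<in> carrier_mat n n" using A by (simp add: SU_def)
    moreover have "A $$ (k, j) = 0" if "k < n" "j < n" "k \<noteq> j" for k j
      using A(2) A' that by (simp add: diagonal_mat_def)
    ultimately have "\<forall>i<n. cmod (A $$ (i, i)) = 1" "(\<Prod>i<n. A $$ (i, i)) = 1"
      using A(1) diagonal_SU_iff by blast+
    moreover have "(\<Prod>i=1..n. diag_entries n A i) = (\<Prod>i<n. A $$ (i, i))"
      unfolding prod_shift[symmetric] by (simp add: diag_entries_def)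
    ultimately show ?thesis by (auto simp: diag_entries_def)
  qed
  moreover have "t \<in> diag_entries n ` {A \<in> carrier (SU n). diagonal_mat A}" if t: "t \<in> ?T" for t
  proof
    let ?A = "Matrix.mat n n (\<lambda>(i, j). if i = j then t (Suc i) else 0)"
    have "?A \<in> carrier (SU n)"
      using t diagonal_SU_iff[of ?A n] prod_shift[of t n] by auto
    then show "?A \<in> {A \<in> carrier (SU n). diagonal_mat A}" by (auto simp: diagonal_mat_def)
    show "t = diag_entries n ?A"
      using t by (intro extensionalityI[of t "{1..n}"]) (auto simp: diag_entries_def)
  qed
  ultimately show ?thesis by (auto simp: torus_def)
qed

lemma torus_norm: "t \<in> carrier (torus n) \<Longrightarrow> 1 \<le> i \<Longrightarrow> i \<le> n \<Longrightarrow> cmod (t i) = 1"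
  by (simp add: carrier_torus)

lemma torus_simps:
  "x \<otimes>\<^bsub>torus n\<^esub> y = (\<lambda>i\<in>{1..n}. x i * y i)" "\<one>\<^bsub>torus n\<^esub> = (\<lambda>i\<in>{1..n}. 1)"
  by (simp_all add: torus_def product_group_def)

lemma torus_mult_closed:
  assumes "s \<in> carrier (torus n)" "t \<in> carrier (torus n)"
  shows "s \<otimes>\<^bsub>torus n\<^esub> t \<in> carrier (torus n)"
proof -
  have "(\<Prod>i=1..n. (s \<otimes>\<^bsub>torus n\<^esub> t) i) = (\<Prod>i=1..n. s i * t i)"
    by (intro prod.cong) (auto simp: torus_simps)
  then show ?thesis
    using assms by (simp add: carrier_torus prod.distrib) (simp add: torus_simps norm_mult)
qed

lemma weight_lattice_simps:
  "l \<otimes>\<^bsub>weight_lattice n\<^esub> m = (\<lambda>t\<in>carrier (torus n). l t * m t)"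
  "\<one>\<^bsub>weight_lattice n\<^esub> = (\<lambda>t\<in>carrier (torus n). 1)"
  by (simp_all add: weight_lattice_def product_group_def)

lemma carrier_weight_lattice:
  "l \<in> carrier (weight_lattice n) \<longleftrightarrow>
    l \<in> extensional (carrier (torus n)) \<and> (\<forall>t\<in>carrier (torus n). cmod (l t) = 1) \<and>
    (\<forall>s\<in>carrier (torus n). \<forall>t\<in>carrier (torus n). l (s \<otimes>\<^bsub>torus n\<^esub> t) = l s * l t) \<and>
    continuous_on (carrier (torus n)) l"
  by (auto simp: weight_lattice_def hom_def)

text \<open>The last coordinate of a torus point is the inverse of the product of the others.
  Leaving it out makes the exponents unique; values of \<open>k\<close> outside
  \<open>{1..n - 1}\<close> are ignored.\<close>

definition weight :: "nat \<Rightarrow> (nat \<Rightarrow> int) \<Rightarrow> (nat \<Rightarrow> complex) \<Rightarrow> complex"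
  where "weight n k = (\<lambda>t\<in>carrier (torus n). \<Prod>i=1..n - 1. t i powi k i)"

lemma weight_in: "weight n k \<in> carrier (weight_lattice n)"
proof -
  \<comment> \<open>Exponents may be negative, so continuity of the powers depends on nonzero
    coordinates.\<close>
  have nz: "t i \<noteq> 0" if "t \<in> carrier (torus n)" "i \<in> {1..n - 1}" for t i
  proof -
    have "cmod (t i) = 1" using that by (intro torus_norm) auto
    then show ?thesis by auto
  qed
  have "continuous_on (carrier (torus n)) (\<lambda>t. \<Prod>i=1..n - 1. t i powi k i)"
    by (intro continuous_intros continuous_on_subset[OF continuous_on_product_coordinates]) (auto simp: nz)
  then have "continuous_on (carrier (torus n)) (weight n k)"
    by (rule continuous_on_eq) (simp add: weight_def)
  moreover have "cmod (weight n k t) = 1" if "t \<in> carrier (torus n)" for t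
  proof -
    have "cmod (weight n k t) = (\<Prod>i=1..n - 1. cmod (t i powi k i))"
      using that by (simp add: weight_def prod_norm)
    also have "\<dots> = 1"
      using that by (intro prod.neutral ballI cmod_powi torus_norm) auto
    finally show ?thesis .
  qed
  moreover have "weight n k (s \<otimes>\<^bsub>torus n\<^esub> t) = weight n k s * weight n k t"
    if st: "s \<in> carrier (torus n)" "t \<in> carrier (torus n)" for s t
  proof -
    have "(\<Prod>i=1..n - 1. (s \<otimes>\<^bsub>torus n\<^esub> t) i powi k i) =
        (\<Prod>i=1..n - 1. s i powi k i * t i powi k i)"
      by (intro prod.cong) (auto simp: torus_simps power_int_mult_distrib)
    with st show ?thesis by (simp add: weight_def torus_mult_closed prod.distrib)
  qed
  ultimately show ?thesis by (auto simp: carrier_weight_lattice weight_def)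
qed

lemma weight_mult: "weight n k \<otimes>\<^bsub>weight_lattice n\<^esub> weight n m = weight n (\<lambda>i. k i + m i)"
proof
  fix t
  show "(weight n k \<otimes>\<^bsub>weight_lattice n\<^esub> weight n m) t = weight n (\<lambda>i. k i + m i) t"
  proof (cases "t \<in> carrier (torus n)")
    case True
    have "(\<Prod>i=1..n - 1. t i powi (k i + m i)) = (\<Prod>i=1..n - 1. t i powi k i * t i powi m i)"
    proof (intro prod.cong refl)
      fix i assume "i \<in> {1..n - 1}"
      then have "cmod (t i) = 1" using True by (intro torus_norm) auto
      then show "t i powi (k i + m i) = t i powi k i * t i powi m i"
        by (intro power_int_add) auto
    qed
    with True show ?thesis by (simp add: weight_lattice_simps weight_def prod.distrib)
  qed (simp add: weight_lattice_simps weight_def)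
qed

lemma weight_one: "\<one>\<^bsub>weight_lattice n\<^esub> = weight n (\<lambda>_. 0)"
  by (simp add: weight_lattice_simps weight_def)

lemma weight_cong: "(\<And>i. i \<in> {1..n - 1} \<Longrightarrow> k i = m i) \<Longrightarrow> weight n k = weight n m"
  by (simp add: weight_def)

text \<open>The \<open>i\<close>-th coordinate circle for \<open>i < n\<close>, with the last entry
  restoring determinant 1. Restricting a weight to it isolates the exponent at
  \<open>i\<close>.\<close>

definition torus_point :: "nat \<Rightarrow> nat \<Rightarrow> complex \<Rightarrow> nat \<Rightarrow> complex"
  where "torus_point n i z = (\<lambda>j\<in>{1..n}. if j = i then z else if j = n then inverse z else 1)"

lemma torus_point_in:
  assumes "i \<in> {1..n - 1}" "cmod z = 1"
  shows "torus_point n i z \<in> carrier (torus n)"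
proof -
  have "(\<Prod>j=1..n. torus_point n i z j) =
      (\<Prod>j=1..n. (if j = i then z else 1) * (if j = n then inverse z else 1))"
    using assms by (intro prod.cong) (auto simp: torus_point_def)
  also have "\<dots> = z * inverse z"
  proof -
    have "i \<in> {1..n}" "n \<in> {1..n}" using assms by auto
    then show ?thesis by (simp add: prod.distrib)
  qed
  also have "\<dots> = 1" using assms by (intro right_inverse) auto
  finally show ?thesis
    using assms by (auto simp: carrier_torus torus_point_def norm_inverse)
qed

lemma weight_torus_point:
  assumes "i \<in> {1..n - 1}" "cmod z = 1"
  shows "weight n k (torus_point n i z) = z powi k i"
proof -
  have "weight n k (torus_point n i z) = (\<Prod>j=1..n - 1. torus_point n i z j powi k j)"
    using torus_point_in[OF assms] by (simp add: weight_def)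
  also have "\<dots> = (\<Prod>j=1..n - 1. if j = i then z powi k i else 1)"
    using assms by (intro prod.cong) (auto simp: torus_point_def)
  finally show ?thesis using assms by simp
qed

lemma powi_circle_inj:
  assumes "\<And>z. cmod z = 1 \<Longrightarrow> z powi a = z powi b"
  shows "a = b"
proof (rule ccontr)
  assume ne: "a \<noteq> b"
  \<comment> \<open>Chosen so that \<open>z powi (a - b)\<close> is \<open>cis pi\<close>, that is
    -1.\<close>
  define z where "z = cis (pi / of_int (a - b))"
  have "z powi a = z powi b" using assms by (simp add: z_def)
  then have "z powi (a - b) = 1" by (simp add: power_int_diff z_def)
  moreover have "z powi (a - b) = -1" using ne by (simp add: z_def cis_power_int del: of_int_diff)
  ultimately show False by simp
qed

lemma weight_eq_iff: "weight n k = weight n m \<longleftrightarrow> (\<forall>i\<in>{1..n - 1}. k i = m i)"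
proof
  assume eq: "weight n k = weight n m"
  show "\<forall>i\<in>{1..n - 1}. k i = m i"
    using weight_torus_point[of _ n _ k] weight_torus_point[of _ n _ m]
    by (auto intro!: powi_circle_inj simp: eq)
qed (auto intro: weight_cong)

text \<open>On each coordinate circle a weight is a continuous character, hence a power map by
  \<open>circle_character\<close>. The coordinate circles generate the torus, so these
  \<open>n - 1\<close> exponents determine the weight.\<close>

lemma weight_lattice_weight:
  assumes n: "n \<ge> 2" and l: "l \<in> carrier (weight_lattice n)"
  obtains k where "l = weight n k"
proof -
  have ext: "l \<in> extensional (carrier (torus n))"
    and norm: "\<And>t. t \<in> carrier (torus n) \<Longrightarrow> cmod (l t) = 1"
    and mult: "\<And>s t. s \<in> carrier (torus n) \<Longrightarrow> t \<in> carrier (torus n) \<Longrightarrow>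
      l (s \<otimes>\<^bsub>torus n\<^esub> t) = l s * l t"
    and cont: "continuous_on (carrier (torus n)) l"
    using l unfolding carrier_weight_lattice by blast+
  have one_in: "\<one>\<^bsub>torus n\<^esub> \<in> carrier (torus n)"
    by (simp add: carrier_torus torus_simps)
  have l1: "l \<one>\<^bsub>torus n\<^esub> = 1"
  proof -
    have "\<one>\<^bsub>torus n\<^esub> \<otimes>\<^bsub>torus n\<^esub> \<one>\<^bsub>torus n\<^esub> = \<one>\<^bsub>torus n\<^esub>"
      by (auto simp: torus_simps)
    then have "l \<one>\<^bsub>torus n\<^esub> = l \<one>\<^bsub>torus n\<^esub> * l \<one>\<^bsub>torus n\<^esub>" using mult[OF one_in one_in] by simp
    moreover have "cmod (l \<one>\<^bsub>torus n\<^esub>) = 1" using norm[OF one_in] .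
    ultimately show ?thesis by (metis mult_cancel_left2 norm_zero zero_neq_one)
  qed
  have "\<exists>k. \<forall>z. cmod z = 1 \<longrightarrow> l (torus_point n i z) = z powi k" if i: "i \<in> {1..n - 1}" for i
  proof -
    define g where "g x = l (torus_point n i (cis x))" for x
    have "continuous_on UNIV (\<lambda>x. torus_point n i (cis x) j)" for j
      unfolding torus_point_def restrict_def
      by (cases "j \<in> {1..n}"; cases "j = i"; cases "j = n") (auto intro!: continuous_intros)
    then have "continuous_on UNIV (\<lambda>x. torus_point n i (cis x))"
      by (rule continuous_on_coordinatewise_then_product)
    then have g1: "continuous_on UNIV g" unfolding g_def
      by (rule continuous_on_compose2[OF cont]) (auto intro: torus_point_in[OF i])
    have g2: "g (x + y) = g x * g y" for x y
    proof -
      have "torus_point n i (cis (x + y)) =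
          torus_point n i (cis x) \<otimes>\<^bsub>torus n\<^esub> torus_point n i (cis y)"
        by (auto simp: torus_simps torus_point_def simp flip: cis_mult)
      then show ?thesis using mult torus_point_in[OF i] by (simp add: g_def)
    qed
    have g3: "g (2 * pi) = 1"
    proof -
      have "torus_point n i (cis (2 * pi)) = \<one>\<^bsub>torus n\<^esub>"
        by (auto simp: torus_simps torus_point_def)
      then show ?thesis using l1 by (simp add: g_def)
    qed
    obtain k where k: "\<And>x. g x = cis x powi k" by (rule circle_character[OF g1 g2 g3]) (rule that)
    have "l (torus_point n i z) = z powi k" if "cmod z = 1" for z
      using k[of "Arg z"] that cis_Arg[of z] unfolding g_def
      by (metis div_by_1 norm_zero of_real_1 sgn_eq zero_neq_one)
    then show ?thesis by blast
  qed
  then obtain k where k: "\<And>i z. i \<in> {1..n - 1} \<Longrightarrow> cmod z = 1 \<Longrightarrow> l (torus_point n i z) = z powi k i"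
    by metis
  have "l t = weight n k t" if t: "t \<in> carrier (torus n)" for t
  proof -
    \<comment> \<open>The product of the first \<open>m\<close> coordinate-circle points of
      \<open>t\<close>: it agrees with \<open>t\<close> up to \<open>m\<close>, and the last entry
      compensates. At \<open>m = n - 1\<close> it is \<open>t\<close> itself, because the product of
      all coordinates being 1 forces the last one.\<close>
    define p where "p m = (\<lambda>j\<in>{1..n}. if j \<le> m then t j
        else if j = n then inverse (\<Prod>i=1..m. t i) else 1)" for m
    have t1: "cmod (t i) = 1" if "i \<in> {1..n}" for i using t that by (simp add: carrier_torus)
    have "p m \<in> carrier (torus n) \<and> l (p m) = (\<Prod>i=1..m. t i powi k i)" if "m \<le> n - 1" for m
      using that
    proof (induction m)
      case 0
      have "p 0 = \<one>\<^bsub>torus n\<^esub>" by (auto simp: p_def torus_simps)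
      then show ?case using l1 one_in by simp
    next
      case (Suc m)
      have m: "Suc m \<in> {1..n - 1}" "cmod (t (Suc m)) = 1" using Suc.prems t1[of "Suc m"] by auto
      have "p (Suc m) = p m \<otimes>\<^bsub>torus n\<^esub> torus_point n (Suc m) (t (Suc m))"
        using m(1) by (auto simp: p_def torus_simps torus_point_def le_Suc_eq intro!: restrict_ext)
      moreover have "p m \<otimes>\<^bsub>torus n\<^esub> torus_point n (Suc m) (t (Suc m)) \<in> carrier (torus n)"
        using Suc torus_point_in[OF m] by (auto intro: torus_mult_closed)
      ultimately show ?case using Suc torus_point_in[OF m] k[OF m] mult by simp
    qed
    then have "l (p (n - 1)) = weight n k t" using t by (simp add: weight_def)
    moreover have "p (n - 1) = t"
    proof -
      have "{1..n} = insert n {1..n - 1}" using n by auto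
      moreover have "(\<Prod>i=1..n. t i) = 1" using t by (simp add: carrier_torus)
      ultimately have "t n * (\<Prod>i=1..n - 1. t i) = 1" using n by simp
      then have "t n = inverse (\<Prod>i=1..n - 1. t i)"
        by (metis inverse_unique mult.commute)
      moreover have "t j = undefined" if "j \<notin> {1..n}" for j
        using t that by (auto simp: carrier_torus extensional_def)
      ultimately show ?thesis by (auto simp: p_def fun_eq_iff le_less restrict_def)
    qed
    ultimately show ?thesis by simp
  qed
  then have "l = weight n k"
    using ext by (intro extensionalityI[of l "carrier (torus n)"]) (auto simp: weight_def)
  then show thesis by (rule that)
qed

section \<open>The weight lattice as a group, computed on exponent vectors\<close>

lemma weight_lattice_comm_group: assumes "n \<ge> 2" shows "comm_group (weight_lattice n)"
proof (rule comm_groupI)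
  fix x assume "x \<in> carrier (weight_lattice n)"
  then obtain k where "x = weight n k" using weight_lattice_weight[OF assms] by blast
  then have "weight n (\<lambda>i. - k i) \<otimes>\<^bsub>weight_lattice n\<^esub> x = \<one>\<^bsub>weight_lattice n\<^esub>"
    by (simp add: weight_mult weight_one)
  then show "\<exists>y\<in>carrier (weight_lattice n). y \<otimes>\<^bsub>weight_lattice n\<^esub> x = \<one>\<^bsub>weight_lattice n\<^esub>"
    using weight_in by blast
qed (auto elim!: weight_lattice_weight[OF assms] simp: weight_mult weight_one weight_in algebra_simps)

lemma weight_inv:
  assumes "n \<ge> 2" shows "inv\<^bsub>weight_lattice n\<^esub> weight n k = weight n (\<lambda>i. - k i)"
proof -
  interpret comm_group "weight_lattice n" by (rule weight_lattice_comm_group[OF assms])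
  show ?thesis by (rule inv_equality) (simp_all add: weight_mult weight_one weight_in)
qed

section \<open>Degrees and root coordinates\<close>

text \<open>The degree in exponent coordinates: each \<open>L_i\<close> contributes -1, and
  \<open>L_1\<close> an additional \<open>n\<close>.\<close>

definition wdeg :: "nat \<Rightarrow> (nat \<Rightarrow> int) \<Rightarrow> int"
  where "wdeg n k = int n * k 1 - (\<Sum>i=1..n - 1. k i)"

text \<open>Exponents of \<open>L_i\<close>. The relation that all \<open>L_i\<close> sum to zero
  makes \<open>L_n\<close> the vector with all entries -1.\<close>

definition fund_coord :: "nat \<Rightarrow> nat \<Rightarrow> nat \<Rightarrow> int"
  where "fund_coord n i j = (if i = n then - 1 else of_bool (j = i))"

definition root_coord :: "nat \<Rightarrow> nat \<Rightarrow> nat \<Rightarrow> int"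
  where "root_coord n i j = fund_coord n i j - fund_coord n (i + 1) j"

text \<open>With \<open>K\<close> the sum of all exponents, shifting them by \<open>K/n\<close>
  makes the \<open>n\<close> coordinates sum to zero. The exact coefficient of
  \<open>\<alpha>_i\<close> is then the partial sum \<open>k_1 + ... + k_i - i K/n\<close>, and
  \<open>- K/n\<close> equals \<open>wdeg n k / n - k_1\<close>. The definition rounds the one
  fraction down.\<close>

definition root_coeff :: "nat \<Rightarrow> nat \<Rightarrow> (nat \<Rightarrow> int) \<Rightarrow> int"
  where "root_coeff n i k = (\<Sum>j=1..i. k j) + int i * (wdeg n k div int n - k 1)"

lemma wdeg_add: "wdeg n (\<lambda>i. k i + m i) = wdeg n k + wdeg n m"
  by (simp add: wdeg_def sum.distrib algebra_simps)

lemma wdeg_diff: "wdeg n (\<lambda>i. k i - m i) = wdeg n k - wdeg n m"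
  by (simp add: wdeg_def sum_subtractf algebra_simps)

lemma wdeg_uminus: "wdeg n (\<lambda>i. - k i) = - wdeg n k"
  by (simp add: wdeg_def sum_negf)

lemma wdeg_cong: "n \<ge> 2 \<Longrightarrow> (\<And>i. i \<in> {1..n - 1} \<Longrightarrow> k i = m i) \<Longrightarrow> wdeg n k = wdeg n m"
  by (simp add: wdeg_def)

lemma root_coeff_cong:
  assumes "i \<in> {1..n - 1}" "\<And>i. i \<in> {1..n - 1} \<Longrightarrow> k i = m i"
  shows "root_coeff n i k = root_coeff n i m"
proof -
  have "(\<Sum>j=1..i. k j) = (\<Sum>j=1..i. m j)" using assms by (intro sum.cong) auto
  moreover have "wdeg n k = wdeg n m" using assms by (intro wdeg_cong) auto
  ultimately show ?thesis using assms by (auto simp: root_coeff_def)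
qed

lemma wdeg_fund_coord:
  assumes "n \<ge> 2" "i \<in> {1..n}"
  shows "wdeg n (fund_coord n i) = (if i = 1 then int n - 1 else - 1)"
  using assms by (auto simp: wdeg_def fund_coord_def of_bool_def)

lemma wdeg_root_coord:
  assumes "n \<ge> 2" "i \<in> {1..n - 1}"
  shows "wdeg n (root_coord n i) = int n * of_bool (i = 1)"
proof -
  have "root_coord n i = (\<lambda>j. fund_coord n i j - fund_coord n (i + 1) j)"
    by (simp add: root_coord_def fun_eq_iff)
  moreover have "i \<in> {1..n}" "i + 1 \<in> {1..n}" using assms by auto
  ultimately show ?thesis using assms(1) by (simp add: wdeg_diff wdeg_fund_coord)
qed

text \<open>The simple root \<open>\<alpha>_1\<close> has degree \<open>n\<close> and the others
  degree 0, so the rounded quotient jumps by exactly one for \<open>j = 1\<close>. This cancels the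
  term \<open>- int i * of_bool (j = 1)\<close> left over from the partial sums.\<close>

lemma root_coeff_add_root:
  assumes n: "n \<ge> 2" and i: "i \<in> {1..n - 1}" and j: "j \<in> {1..n - 1}"
  shows "root_coeff n i (\<lambda>l. k l + root_coord n j l) = root_coeff n i k + of_bool (i = j)"
proof -
  \<comment> \<open>For \<open>L_n\<close> the partial sum \<open>- i\<close> cancels against
    \<open>i\<close> times the first entry -1, whence the separate value 0. It occurs below as
    \<open>j + 1 = n\<close>.\<close>
  have s: "(\<Sum>l=1..i. fund_coord n j l) - int i * fund_coord n j 1 =
      (if j = n then 0 else of_bool (j \<le> i) - int i * of_bool (j = 1))" if "j \<in> {1..n}" for j
    using that i by (auto simp: fund_coord_def of_bool_def)
  have "(\<Sum>l=1..i. root_coord n j l) - int i * root_coord n j 1 = of_bool (i = j) - int i * of_bool (j = 1)"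
    using s[of j] s[of "j + 1"] i j by (auto simp: root_coord_def sum_subtractf algebra_simps)
  moreover have "wdeg n (\<lambda>l. k l + root_coord n j l) div int n = wdeg n k div int n + of_bool (j = 1)"
    using n j by (auto simp: wdeg_add wdeg_root_coord)
  ultimately show ?thesis by (simp add: root_coeff_def sum.distrib algebra_simps)
qed

text \<open>All of \<open>root_coeff\<close> is linear in the exponents except the rounded quotient,
  whose additivity defect is \<open>omega\<close> by definition.\<close>

lemma root_coeff_add:
  "root_coeff n i (\<lambda>j. k j + m j) =
    root_coeff n i k + root_coeff n i m + int i * omega n (wdeg n k) (wdeg n m)"
  by (simp add: root_coeff_def omega_def wdeg_add sum.distrib algebra_simps)

section \<open>Fundamental weights, the degree map and the root lattice in exponent
  coordinates\<close>

lemma fund_weight_eq: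
  assumes n: "n \<ge> 2" and i: "i \<in> {1..n}"
  shows "fund_weight n i = weight n (fund_coord n i)"
proof -
  have "t i = (\<Prod>j=1..n - 1. t j powi fund_coord n i j)" if t: "t \<in> carrier (torus n)" for t
  proof (cases "i = n")
    case True
    have "{1..n} = insert n {1..n - 1}" using n by auto
    moreover have "(\<Prod>i=1..n. t i) = 1" using t by (simp add: carrier_torus)
    ultimately have "t n * (\<Prod>i=1..n - 1. t i) = 1" using n by simp
    then have "t n = inverse (\<Prod>i=1..n - 1. t i)" by (metis inverse_unique mult.commute)
    then show ?thesis using True by (simp add: fund_coord_def power_int_minus prod_inversef[symmetric] comp_def)
  next
    case False
    have "(\<Prod>j=1..n - 1. t j powi fund_coord n i j) = (\<Prod>j=1..n - 1. if j = i then t i else 1)"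
      using False by (intro prod.cong) (auto simp: fund_coord_def)
    then show ?thesis using i False by auto
  qed
  then show ?thesis by (auto simp: fund_weight_def weight_def)
qed

text \<open>Existence: \<open>wdeg\<close> of a chosen exponent vector is well defined, since the
  relevant exponents are unique. Uniqueness: a homomorphism to the integers is determined by its
  values on \<open>L_1, ..., L_{n-1}\<close>, which are prescribed.\<close>

lemma weight_degree_weight:
  assumes n: "n \<ge> 2"
  shows "weight_degree n (weight n k) = wdeg n k"
proof -
  let ?P = "carrier (weight_lattice n)"
  define h0 where "h0 = (\<lambda>l\<in>?P. wdeg n (SOME k. l = weight n k))"
  have h0w: "h0 (weight n k) = wdeg n k" for k
  proof -
    have "weight n k = weight n (SOME m. weight n k = weight n m)" using someI[of "\<lambda>m. weight n k = weight n m" k] by simp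
    then have "wdeg n (SOME m. weight n k = weight n m) = wdeg n k"
      using n by (intro wdeg_cong) (auto simp: weight_eq_iff)
    then show ?thesis by (simp add: h0_def weight_in)
  qed
  have hom: "h0 \<in> hom (weight_lattice n) integer_group"
    by (rule homI) (auto elim!: weight_lattice_weight[OF n] simp: weight_mult h0w wdeg_add)
  have vals: "h0 (fund_weight n 1) = int n - 1" "\<forall>i\<in>{2..n}. h0 (fund_weight n i) = - 1"
    using n by (auto simp: fund_weight_eq h0w wdeg_fund_coord)
  have "weight_degree n = h0" unfolding weight_degree_def
  proof (rule the_equality)
    show "h0 \<in> extensional ?P \<and> h0 \<in> hom (weight_lattice n) integer_group \<and>
      h0 (fund_weight n 1) = int n - 1 \<and> (\<forall>i\<in>{2..n}. h0 (fund_weight n i) = - 1)"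
      using hom vals by (simp add: h0_def)
    fix h assume h: "h \<in> extensional ?P \<and> h \<in> hom (weight_lattice n) integer_group \<and>
      h (fund_weight n 1) = int n - 1 \<and> (\<forall>i\<in>{2..n}. h (fund_weight n i) = - 1)"
    have expand: "g (weight n k) = (\<Sum>i=1..n - 1. k i * g (fund_weight n i))"
      if g: "g \<in> hom (weight_lattice n) integer_group" for g k
    proof -
      have "g (weight n k) = (\<Sum>i\<in>{1..n - 1}. k i * g (weight n (\<lambda>j. of_bool (j = i))))"
      proof (rule additive_on_int_vectors)
        fix k m show "g (weight n (\<lambda>i. k i + m i)) = g (weight n k) + g (weight n m)"
          using hom_mult[OF g weight_in weight_in] by (simp add: weight_mult)
      next
        fix k m :: "nat \<Rightarrow> int"
        assume "\<And>i. i \<in> {1..n - 1} \<Longrightarrow> k i = m i"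
        then have "weight n k = weight n m" by (rule weight_cong)
        then show "g (weight n k) = g (weight n m)" by simp
      qed simp
      also have "\<dots> = (\<Sum>i=1..n - 1. k i * g (fund_weight n i))"
      proof (intro sum.cong refl)
        fix i assume "i \<in> {1..n - 1}"
        then have "fund_weight n i = weight n (\<lambda>j. of_bool (j = i))"
          using n by (subst fund_weight_eq) (auto simp: weight_eq_iff fund_coord_def)
        then show "k i * g (weight n (\<lambda>j. of_bool (j = i))) = k i * g (fund_weight n i)" by simp
      qed
      finally show ?thesis .
    qed
    have eq: "h (fund_weight n i) = h0 (fund_weight n i)" if "i \<in> {1..n - 1}" for i
      using that h vals by (cases "i = 1") auto
    show "h = h0"
    proof (rule extensionalityI[of _ ?P])
      fix l assume "l \<in> ?P"
      then obtain k where "l = weight n k" using weight_lattice_weight[OF n] by blast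
      then show "h l = h0 l" using expand[of h k] expand[OF hom, of k] h eq by simp
    qed (use h in \<open>auto simp: h0_def\<close>)
  qed
  then show ?thesis by (simp add: h0w)
qed

lemma simple_root_eq:
  assumes "n \<ge> 2" "i \<in> {1..n - 1}"
  shows "simple_root n i = weight n (root_coord n i)"
proof -
  have "fund_weight n (i + 1) = weight n (fund_coord n (i + 1))"
    "fund_weight n i = weight n (fund_coord n i)"
    using assms by (auto intro!: fund_weight_eq)
  then show ?thesis
    using assms by (simp add: simple_root_def weight_inv weight_mult weight_eq_iff root_coord_def)
qed

lemma root_lattice_subgroup:
  assumes "n \<ge> 2" shows "subgroup (root_lattice n) (weight_lattice n)"
proof -
  interpret comm_group "weight_lattice n" by (rule weight_lattice_comm_group[OF assms])
  show ?thesis unfolding root_lattice_def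
    using assms by (intro generate_is_subgroup) (auto simp: simple_root_eq weight_in)
qed

text \<open>Induction over the generated subgroup: the generators have degree \<open>n\<close> or
  0.\<close>

lemma root_lattice_weight:
  assumes n: "n \<ge> 2" and a: "a \<in> root_lattice n"
  obtains k where "a = weight n k" "int n dvd wdeg n k"
proof -
  have "\<exists>k. a = weight n k \<and> int n dvd wdeg n k"
    using a unfolding root_lattice_def
  proof (induction rule: generate.induct)
    case one
    then show ?case by (intro exI[of _ "\<lambda>_. 0"]) (simp add: weight_one wdeg_def)
  next
    case (incl h)
    then show ?case using n by (auto simp: simple_root_eq wdeg_root_coord)
  next
    case (inv h)
    then obtain i where i: "i \<in> {1..n - 1}" "h = simple_root n i" by auto
    then show ?case using n
      by (intro exI[of _ "\<lambda>j. - root_coord n i j"])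
        (simp add: simple_root_eq wdeg_root_coord weight_inv wdeg_uminus)
  next
    case (eng h1 h2)
    then obtain k m where "h1 = weight n k" "int n dvd wdeg n k" "h2 = weight n m" "int n dvd wdeg n m"
      by blast
    then show ?case
      by (intro exI[of _ "\<lambda>i. k i + m i"]) (simp add: weight_mult wdeg_add)
  qed
  then show thesis using that by blast
qed

lemma weight_degree_mult:
  assumes "n \<ge> 2" "l \<in> carrier (weight_lattice n)" "m \<in> carrier (weight_lattice n)"
  shows "weight_degree n (l \<otimes>\<^bsub>weight_lattice n\<^esub> m) = weight_degree n l + weight_degree n m"
proof -
  obtain k k' where "l = weight n k" "m = weight n k'"
    using assms weight_lattice_weight by metis
  then show ?thesis using assms(1) by (simp add: weight_mult weight_degree_weight wdeg_add)
qed

lemma weight_degree_root_lattice: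
  assumes "n \<ge> 2" "a \<in> root_lattice n"
  shows "int n dvd weight_degree n a"
  by (rule root_lattice_weight[OF assms]) (simp add: weight_degree_weight[OF assms(1)])

text \<open>Elements of a coset differ by roots, whose degrees are multiples of \<open>n\<close>;
  hence the image under \<open>the_elem\<close> in \<open>coset_degree\<close> is a
  singleton.\<close>

lemma coset_degree_coset:
  assumes n: "n \<ge> 2" and l: "l \<in> carrier (weight_lattice n)"
  shows "coset_degree n (root_lattice n #>\<^bsub>weight_lattice n\<^esub> l) = weight_degree n l mod int n"
proof -
  let ?X = "root_lattice n #>\<^bsub>weight_lattice n\<^esub> l"
  interpret comm_group "weight_lattice n" by (rule weight_lattice_comm_group[OF n])
  interpret Q: subgroup "root_lattice n" "weight_lattice n" by (rule root_lattice_subgroup[OF n])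
  have "weight_degree n x mod int n = weight_degree n l mod int n" if x: "x \<in> ?X" for x
  proof -
    obtain a where a: "a \<in> root_lattice n" "x = a \<otimes>\<^bsub>weight_lattice n\<^esub> l"
      using x by (auto simp: r_coset_def)
    then show ?thesis
      using n l Q.mem_carrier weight_degree_root_lattice[OF n a(1)]
      by (auto simp: weight_degree_mult elim!: dvdE)
  qed
  moreover have "l \<in> ?X" using l Q.subset by (simp add: rcos_self root_lattice_subgroup n)
  ultimately have "(\<lambda>l. weight_degree n l mod int n) ` ?X = {weight_degree n l mod int n}" by blast
  then show ?thesis by (simp add: coset_degree_def)
qed

section \<open>The centre of the special unitary group\<close>

text \<open>Two families of test elements suffice: diagonal matrices kill the off-diagonal entries,
  and signed transpositions equate the diagonal ones. The determinant then gives the root of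
  unity.\<close>

lemma group_center_SU_scalar:
  assumes n: "n \<ge> 2" and z: "z \<in> carrier (group_center (SU n))"
  obtains c where "z = c \<cdot>\<^sub>m 1\<^sub>m n" "c ^ n = 1"
proof -
  have zc: "z \<in> carrier_mat n n" and det: "det z = 1"
    and comm: "\<And>g. g \<in> carrier (SU n) \<Longrightarrow> z * g = g * z"
    using z by (auto simp: group_center_def SU_def)
  have off: "z $$ (a, b) = 0" if ab: "a < n" "b < n" "a \<noteq> b" for a b
  proof -
    \<comment> \<open>The entries \<open>\<i>\<close> and \<open>- \<i>\<close> have product 1 and
      are distinct, so commutation at \<open>(a, b)\<close> reads
      \<open>- \<i> * z_ab = \<i> * z_ab\<close>. Two entries -1 would also give determinant 1 but
      no information there.\<close>
    define g where "g = Matrix.mat n n (\<lambda>(i, j).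
      if i = j then if i = a then \<i> else if i = b then - \<i> else 1 else 0 :: complex)"
    have gc: "g \<in> carrier_mat n n" by (simp add: g_def)
    have "(\<Prod>i<n. g $$ (i, i)) = (\<Prod>i<n. (if i = a then \<i> else 1) * (if i = b then - \<i> else 1))"
      using ab by (intro prod.cong) (auto simp: g_def)
    also have "\<dots> = 1" using ab by (simp add: prod.distrib)
    finally have "g \<in> carrier (SU n)"
      by (subst diagonal_SU_iff) (auto simp: g_def)
    then have "(z * g) $$ (a, b) = (g * z) $$ (a, b)" using comm by simp
    moreover have "(z * g) $$ (a, b) = (\<Sum>k<n. z $$ (a, k) * g $$ (k, b))"
      using zc gc ab by (simp add: scalar_prod_def lessThan_atLeast0)
    moreover have "\<dots> = (\<Sum>k<n. if k = b then z $$ (a, b) * - \<i> else 0)"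
      using ab by (intro sum.cong) (auto simp: g_def)
    moreover have "(g * z) $$ (a, b) = (\<Sum>k<n. g $$ (a, k) * z $$ (k, b))"
      using zc gc ab by (simp add: scalar_prod_def lessThan_atLeast0)
    moreover have "\<dots> = (\<Sum>k<n. if k = a then \<i> * z $$ (a, b) else 0)"
      using ab by (intro sum.cong) (auto simp: g_def)
    ultimately show ?thesis using ab by simp
  qed
  have diag: "z $$ (a, a) = z $$ (0, 0)" if a: "a < n" "a \<noteq> 0" for a
  proof -
    \<comment> \<open>The sign on row \<open>a\<close> compensates the determinant -1 of the
      transposition.\<close>
    define g where "g = multrow a (-1) (swaprows 0 a (1\<^sub>m n :: complex mat))"
    have gc: "g \<in> carrier_mat n n" by (simp add: g_def)
    have ge: "g $$ (i, j) = (if i = a then - of_bool (j = 0) else if i = 0 then of_bool (j = a)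
        else of_bool (i = j))" if "i < n" "j < n" for i j
      using that a by (auto simp: g_def)
    have "det g = 1"
      using a n unfolding g_def by (subst det_multrow[of _ n]; simp?) (subst det_swaprows[of _ n]; simp)
    moreover have "(\<Sum>k<n. cnj (g $$ (k, i)) * g $$ (k, j)) = of_bool (i = j)"
      if ij: "i < n" "j < n" for i j
    proof -
      \<comment> \<open>The only row in which column \<open>i\<close> of \<open>g\<close> is
        nonzero.\<close>
      define p where "p = (if i = 0 then a else if i = a then 0 else i)"
      have "(\<Sum>k<n. cnj (g $$ (k, i)) * g $$ (k, j)) = (\<Sum>k<n. if k = p then of_bool (i = j) else 0)"
        using a ij by (intro sum.cong) (auto simp: ge p_def)
      moreover have "p < n" using a ij by (auto simp: p_def)
      ultimately show ?thesis by simp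
    qed
    ultimately have "g \<in> carrier (SU n)" using SU_iff[OF gc] by blast
    then have "(z * g) $$ (0, a) = (g * z) $$ (0, a)" using comm by simp
    moreover have "(z * g) $$ (0, a) = (\<Sum>k<n. if k = 0 then z $$ (0, 0) else 0)"
    proof -
      have "(z * g) $$ (0, a) = (\<Sum>k<n. z $$ (0, k) * g $$ (k, a))"
        using zc gc a by (simp add: scalar_prod_def lessThan_atLeast0)
      also have "\<dots> = (\<Sum>k<n. if k = 0 then z $$ (0, 0) else 0)"
        using a by (intro sum.cong) (auto simp: ge off)
      finally show ?thesis .
    qed
    moreover have "(g * z) $$ (0, a) = (\<Sum>k<n. if k = a then z $$ (a, a) else 0)"
    proof -
      have "(g * z) $$ (0, a) = (\<Sum>k<n. g $$ (0, k) * z $$ (k, a))"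
        using zc gc a by (simp add: scalar_prod_def lessThan_atLeast0)
      also have "\<dots> = (\<Sum>k<n. if k = a then z $$ (a, a) else 0)"
        using a by (intro sum.cong) (auto simp: ge off)
      finally show ?thesis .
    qed
    ultimately show ?thesis using a by simp
  qed
  have "z = z $$ (0, 0) \<cdot>\<^sub>m 1\<^sub>m n"
  proof (rule eq_matI)
    fix i j assume "i < dim_row (z $$ (0, 0) \<cdot>\<^sub>m 1\<^sub>m n)" "j < dim_col (z $$ (0, 0) \<cdot>\<^sub>m 1\<^sub>m n)"
    then show "z $$ (i, j) = (z $$ (0, 0) \<cdot>\<^sub>m 1\<^sub>m n) $$ (i, j)"
      using off[of i j] diag[of i] by (cases "i = j"; cases "i = 0") auto
  qed (use zc in auto)
  moreover have "z $$ (0, 0) ^ n = 1"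
  proof -
    have "(\<Prod>i<n. z $$ (i, i)) = (\<Prod>i<n. z $$ (0, 0))" 
    proof (intro prod.cong refl)
      fix i assume "i \<in> {..<n}"
      then show "z $$ (i, i) = z $$ (0, 0)" using diag[of i] by (cases "i = 0") auto
    qed
    then show ?thesis using det det_diagonal[OF zc off] by simp
  qed
  ultimately show thesis by (rule that)
qed

lemma root_of_unity_norm:
  fixes c :: complex
  assumes "c ^ n = 1" "n \<ge> 2" shows "cmod c = 1"
  using assms by (metis norm_one norm_power power_eq_1_iff norm_ge_zero not_numeral_le_zero)

text \<open>A scalar \<open>c\<close> pairs with a weight as \<open>c\<close> to the sum of its
  exponents. That sum is minus the degree modulo \<open>n\<close>, which is where the inverse comes
  from.\<close>

lemma weight_scalar:
  assumes n: "n \<ge> 2" and c: "c ^ n = 1" and l: "l \<in> carrier (weight_lattice n)"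
  shows "l (diag_entries n (c \<cdot>\<^sub>m 1\<^sub>m n)) = inverse c powi weight_degree n l"
proof -
  obtain k where k: "l = weight n k" using weight_lattice_weight[OF n l] by blast
  have c0: "c \<noteq> 0" using c n by (auto simp: power_0_left)
  have d: "diag_entries n (c \<cdot>\<^sub>m 1\<^sub>m n) = (\<lambda>i\<in>{1..n}. c)"
    unfolding diag_entries_def by (intro restrict_ext) auto
  have "(\<lambda>i\<in>{1..n}. c) \<in> carrier (torus n)"
    using c n by (auto simp: carrier_torus root_of_unity_norm)
  then have "l (diag_entries n (c \<cdot>\<^sub>m 1\<^sub>m n)) = (\<Prod>i=1..n - 1. c powi k i)"
    unfolding d k by (auto simp: weight_def intro!: prod.cong)
  also have "\<dots> = c powi (\<Sum>i=1..n - 1. k i)"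
    using c0 by (induction rule: infinite_finite_induct) (auto simp: power_int_add)
  also have "\<dots> = c powi - wdeg n k"
  proof -
    have "c powi (int n * k 1) = 1" using c by (simp add: power_int_mult)
    then show ?thesis using c0 by (simp add: wdeg_def power_int_diff)
  qed
  finally show ?thesis by (simp add: k weight_degree_weight[OF n] power_int_minus power_int_inverse)
qed

lemma root_of_center_scalar:
  assumes n: "n \<ge> 2" and c: "c ^ n = 1"
  shows "root_of_center n (c \<cdot>\<^sub>m 1\<^sub>m n) = inverse c"
  unfolding root_of_center_def
proof (rule the_equality)
  show "inverse c ^ n = 1 \<and> (\<forall>l\<in>carrier (weight_lattice n).
      l (diag_entries n (c \<cdot>\<^sub>m 1\<^sub>m n)) = inverse c powi weight_degree n l)"
    using c weight_scalar[OF n c] by (simp add: power_inverse)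
  fix z assume z: "z ^ n = 1 \<and> (\<forall>l\<in>carrier (weight_lattice n).
      l (diag_entries n (c \<cdot>\<^sub>m 1\<^sub>m n)) = z powi weight_degree n l)"
  \<comment> \<open>This weight is \<open>L_n\<close>, of degree -1, so evaluating there already
    determines the root of unity.\<close>
  let ?l = "weight n (fund_coord n n)"
  have "z powi weight_degree n ?l = inverse c powi weight_degree n ?l"
    using z weight_scalar[OF n c] weight_in by metis
  then have "inverse z = c"
    using n by (simp add: weight_degree_weight wdeg_fund_coord)
  then show "z = inverse c" by auto
qed

section \<open>Third cohomology and quotients\<close>

lemma cochains2_iff: "f \<in> carrier (cochains2 G) \<longleftrightarrow>
    f \<in> extensional (carrier G \<times> carrier G) \<and>
    (\<forall>x\<in>carrier G. \<forall>y\<in>carrier G. cmod (f (x, y)) = 1)"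
  by (auto simp: cochains2_def PiE_iff)

lemma cochains3_iff: "F \<in> carrier (cochains3 G) \<longleftrightarrow>
    F \<in> extensional (carrier G \<times> carrier G \<times> carrier G) \<and>
    (\<forall>x\<in>carrier G. \<forall>y\<in>carrier G. \<forall>z\<in>carrier G. cmod (F (x, y, z)) = 1)"
  by (auto simp: cochains3_def PiE_iff)

lemma cocycles3_simps:
  "F \<otimes>\<^bsub>cocycles3 G\<^esub> F' = (\<lambda>p\<in>carrier G \<times> carrier G \<times> carrier G. F p * F' p)"
  "\<one>\<^bsub>cocycles3 G\<^esub> = (\<lambda>p\<in>carrier G \<times> carrier G \<times> carrier G. 1)"
  by (simp_all add: cocycles3_def cochains3_def product_group_def)

lemma cocycles3_iff: "F \<in> carrier (cocycles3 G) \<longleftrightarrow> F \<in> carrier (cochains3 G) \<and>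
    (\<forall>x\<in>carrier G. \<forall>y\<in>carrier G. \<forall>z\<in>carrier G. \<forall>w\<in>carrier G.
      F (y, z, w) * inverse (F (x \<otimes>\<^bsub>G\<^esub> y, z, w)) * F (x, y \<otimes>\<^bsub>G\<^esub> z, w)
        * inverse (F (x, y, z \<otimes>\<^bsub>G\<^esub> w)) * F (x, y, z) = 1)"
  by (simp add: cocycles3_def)

lemma cocycles3D:
  assumes "F \<in> carrier (cocycles3 G)"
  shows "F \<in> extensional (carrier G \<times> carrier G \<times> carrier G)"
    and "\<And>x y z. x \<in> carrier G \<Longrightarrow> y \<in> carrier G \<Longrightarrow> z \<in> carrier G \<Longrightarrow> cmod (F (x, y, z)) = 1"
  using assms unfolding cocycles3_iff cochains3_iff by blast+

lemma coboundary2_mult: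
  assumes "group G"
  shows "coboundary2 G (\<lambda>p\<in>carrier G \<times> carrier G. f p * g p) =
    coboundary2 G f \<otimes>\<^bsub>cocycles3 G\<^esub> coboundary2 G g"
proof -
  interpret group G by fact
  show ?thesis by (rule ext) (auto simp: coboundary2_def cocycles3_simps)
qed

lemma coboundary2_cocycle:
  fixes G (structure)
  assumes G: "group G" and f: "f \<in> carrier (cochains2 G)"
  shows "coboundary2 G f \<in> carrier (cocycles3 G)"
proof -
  interpret group G by fact
  have norm: "cmod (f (x, y)) = 1" if "x \<in> carrier G" "y \<in> carrier G" for x y
    using f that by (simp add: cochains2_iff)
  have nz: "f (x, y) \<noteq> 0" if "x \<in> carrier G" "y \<in> carrier G" for x y
    using norm[OF that] by auto
  \<comment> \<open>Ten values of \<open>f\<close> occur, each twice with opposite exponents.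
    Abstracting them to letters keeps the simplifier away from the group products inside the
    arguments.\<close>
  have cancel: "(a * inverse b * c * inverse d) * inverse (a * inverse e * p * inverse q)
      * (b * inverse e * r * inverse s) * inverse (c * inverse p * r * inverse t)
      * (d * inverse q * s * inverse t) = 1"
    if "a \<noteq> 0" "b \<noteq> 0" "c \<noteq> 0" "d \<noteq> 0" "e \<noteq> 0" "p \<noteq> 0" "q \<noteq> 0" "r \<noteq> 0" "s \<noteq> 0" "t \<noteq> 0"
    for a b c d e p q r s t :: complex
    using that by (simp add: field_simps)
  have "coboundary2 G f \<in> carrier (cochains3 G)"
    by (auto simp: cochains3_iff coboundary2_def norm norm_mult norm_inverse)
  moreover have eq: "coboundary2 G f (x, y, z) =
      f (y, z) * inverse (f (x \<otimes> y, z)) * f (x, y \<otimes> z) * inverse (f (x, y))"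
    if "x \<in> carrier G" "y \<in> carrier G" "z \<in> carrier G" for x y z
    using that by (simp add: coboundary2_def)
  have "coboundary2 G f (y, z, w) * inverse (coboundary2 G f (x \<otimes> y, z, w))
      * coboundary2 G f (x, y \<otimes> z, w) * inverse (coboundary2 G f (x, y, z \<otimes> w))
      * coboundary2 G f (x, y, z) = 1"
    if "x \<in> carrier G" "y \<in> carrier G" "z \<in> carrier G" "w \<in> carrier G" for x y z w
    using that by (simp only: eq m_closed m_assoc) (rule cancel; rule nz; simp)
  ultimately show ?thesis unfolding cocycles3_iff by blast
qed

lemma cocycles3_comm_group:
  fixes G (structure)
  assumes "group G" shows "comm_group (cocycles3 G)"
proof -
  interpret group G by fact
  let ?D = "carrier G \<times> carrier G \<times> carrier G"
  show ?thesis
  proof (rule comm_groupI)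
    fix F F' assume F: "F \<in> carrier (cocycles3 G)" "F' \<in> carrier (cocycles3 G)"
    have "(F (y, z, w) * F' (y, z, w)) * inverse (F (x \<otimes> y, z, w) * F' (x \<otimes> y, z, w))
          * (F (x, y \<otimes> z, w) * F' (x, y \<otimes> z, w)) * inverse (F (x, y, z \<otimes> w) * F' (x, y, z \<otimes> w))
          * (F (x, y, z) * F' (x, y, z)) = 1"
      if "x \<in> carrier G" "y \<in> carrier G" "z \<in> carrier G" "w \<in> carrier G" for x y z w
    proof -
      have e: "F (y, z, w) * inverse (F (x \<otimes> y, z, w)) * F (x, y \<otimes> z, w)
          * inverse (F (x, y, z \<otimes> w)) * F (x, y, z) = 1"
        "F' (y, z, w) * inverse (F' (x \<otimes> y, z, w)) * F' (x, y \<otimes> z, w)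
          * inverse (F' (x, y, z \<otimes> w)) * F' (x, y, z) = 1"
        using F that unfolding cocycles3_iff by blast+
      have "(F (y, z, w) * F' (y, z, w)) * inverse (F (x \<otimes> y, z, w) * F' (x \<otimes> y, z, w))
          * (F (x, y \<otimes> z, w) * F' (x, y \<otimes> z, w)) * inverse (F (x, y, z \<otimes> w) * F' (x, y, z \<otimes> w))
          * (F (x, y, z) * F' (x, y, z)) =
        (F (y, z, w) * inverse (F (x \<otimes> y, z, w)) * F (x, y \<otimes> z, w)
          * inverse (F (x, y, z \<otimes> w)) * F (x, y, z)) *
        (F' (y, z, w) * inverse (F' (x \<otimes> y, z, w)) * F' (x, y \<otimes> z, w)
          * inverse (F' (x, y, z \<otimes> w)) * F' (x, y, z))"
        by (simp only: inverse_mult_distrib mult_ac)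
      then show ?thesis unfolding e by simp
    qed
    then show "F \<otimes>\<^bsub>cocycles3 G\<^esub> F' \<in> carrier (cocycles3 G)"
      using cocycles3D(2)[OF F(1)] cocycles3D(2)[OF F(2)]
      unfolding cocycles3_iff cochains3_iff by (auto simp: cocycles3_simps norm_mult)
    show "F \<otimes>\<^bsub>cocycles3 G\<^esub> F' = F' \<otimes>\<^bsub>cocycles3 G\<^esub> F"
      by (simp add: cocycles3_simps mult.commute)
  next
    show "\<one>\<^bsub>cocycles3 G\<^esub> \<in> carrier (cocycles3 G)"
      by (auto simp: cocycles3_iff cochains3_iff cocycles3_simps)
  next
    fix F F' F''
    assume "F \<in> carrier (cocycles3 G)" "F' \<in> carrier (cocycles3 G)" "F'' \<in> carrier (cocycles3 G)"
    show "F \<otimes>\<^bsub>cocycles3 G\<^esub> F' \<otimes>\<^bsub>cocycles3 G\<^esub> F'' =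
        F \<otimes>\<^bsub>cocycles3 G\<^esub> (F' \<otimes>\<^bsub>cocycles3 G\<^esub> F'')"
      by (rule ext) (simp add: cocycles3_simps mult.assoc restrict_def)
  next
    fix F assume F: "F \<in> carrier (cocycles3 G)"
    show "\<one>\<^bsub>cocycles3 G\<^esub> \<otimes>\<^bsub>cocycles3 G\<^esub> F = F"
      by (rule extensionalityI[of _ ?D]) (use cocycles3D(1)[OF F] in \<open>auto simp: cocycles3_simps\<close>)
    have nz: "F (x, y, z) \<noteq> 0" if "x \<in> carrier G" "y \<in> carrier G" "z \<in> carrier G" for x y z
      using cocycles3D(2)[OF F that] by auto
    let ?I = "\<lambda>p\<in>?D. inverse (F p)"
    have "inverse (F (y, z, w)) * inverse (inverse (F (x \<otimes> y, z, w))) * inverse (F (x, y \<otimes> z, w))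
        * inverse (inverse (F (x, y, z \<otimes> w))) * inverse (F (x, y, z)) = 1"
      if "x \<in> carrier G" "y \<in> carrier G" "z \<in> carrier G" "w \<in> carrier G" for x y z w
    proof -
      have "F (y, z, w) * inverse (F (x \<otimes> y, z, w)) * F (x, y \<otimes> z, w)
          * inverse (F (x, y, z \<otimes> w)) * F (x, y, z) = 1"
        using F that unfolding cocycles3_iff by blast
      from arg_cong[OF this, of inverse] show ?thesis
        by (simp only: inverse_mult_distrib inverse_1)
    qed
    then have "?I \<in> carrier (cocycles3 G)"
      using cocycles3D(2)[OF F]
      unfolding cocycles3_iff cochains3_iff by (auto simp: norm_inverse)
    moreover have "?I \<otimes>\<^bsub>cocycles3 G\<^esub> F = \<one>\<^bsub>cocycles3 G\<^esub>"
      by (rule ext) (auto simp: cocycles3_simps nz restrict_def)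
    ultimately show "\<exists>F'\<in>carrier (cocycles3 G). F' \<otimes>\<^bsub>cocycles3 G\<^esub> F = \<one>\<^bsub>cocycles3 G\<^esub>" by blast
  qed
qed

lemma coboundaries3_subgroup:
  assumes G: "group G" shows "subgroup (coboundaries3 G) (cocycles3 G)"
proof -
  interpret C: comm_group "cocycles3 G" by (rule cocycles3_comm_group[OF G])
  interpret group G by fact
  let ?D = "carrier G \<times> carrier G"
  show ?thesis
  proof (rule C.subgroupI)
    show "coboundaries3 G \<subseteq> carrier (cocycles3 G)"
      by (auto simp: coboundaries3_def coboundary2_cocycle[OF G])
    have "(\<lambda>p\<in>?D. 1) \<in> carrier (cochains2 G)" by (auto simp: cochains2_iff)
    then show "coboundaries3 G \<noteq> {}" by (auto simp: coboundaries3_def)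
  next
    fix F assume "F \<in> coboundaries3 G"
    then obtain f where f: "f \<in> carrier (cochains2 G)" "F = coboundary2 G f"
      by (auto simp: coboundaries3_def)
    let ?f = "\<lambda>p\<in>?D. inverse (f p)"
    have f': "?f \<in> carrier (cochains2 G)"
      using f(1) by (auto simp: cochains2_iff norm_inverse)
    have nz: "f (x, y) \<noteq> 0" if "x \<in> carrier G" "y \<in> carrier G" for x y
    proof -
      have "cmod (f (x, y)) = 1" using f(1) that by (simp add: cochains2_iff)
      then show ?thesis by auto
    qed
    have "coboundary2 G ?f \<otimes>\<^bsub>cocycles3 G\<^esub> F = \<one>\<^bsub>cocycles3 G\<^esub>"
      by (rule ext) (auto simp: coboundary2_def cocycles3_simps f(2) nz field_simps)
    then have "inv\<^bsub>cocycles3 G\<^esub> F = coboundary2 G ?f"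
      using f f' coboundary2_cocycle[OF G] by (intro C.inv_equality) auto
    then show "inv\<^bsub>cocycles3 G\<^esub> F \<in> coboundaries3 G"
      using f' by (auto simp: coboundaries3_def)
  next
    fix F F' assume "F \<in> coboundaries3 G" "F' \<in> coboundaries3 G"
    then obtain f f' where f: "f \<in> carrier (cochains2 G)" "f' \<in> carrier (cochains2 G)"
      "F = coboundary2 G f" "F' = coboundary2 G f'"
      by (auto simp: coboundaries3_def)
    have "(\<lambda>p\<in>?D. f p * f' p) \<in> carrier (cochains2 G)"
      using f by (auto simp: cochains2_iff norm_mult)
    then show "F \<otimes>\<^bsub>cocycles3 G\<^esub> F' \<in> coboundaries3 G"
      unfolding f(3,4) coboundary2_mult[OF G, symmetric] by (auto simp: coboundaries3_def)
  qed
qed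

lemma H3_class_in:
  "F \<in> carrier (cocycles3 G) \<Longrightarrow> H3_class G F \<in> carrier (H3 G)"
  by (auto simp: H3_def H3_class_def carrier_FactGroup)

lemma H3_class_mult:
  assumes G: "group G" and F: "F \<in> carrier (cocycles3 G)" "F' \<in> carrier (cocycles3 G)"
  shows "H3_class G F \<otimes>\<^bsub>H3 G\<^esub> H3_class G F' = H3_class G (F \<otimes>\<^bsub>cocycles3 G\<^esub> F')"
proof -
  interpret C: comm_group "cocycles3 G" by (rule cocycles3_comm_group[OF G])
  interpret normal "coboundaries3 G" "cocycles3 G"
    by (rule C.subgroup_imp_normal[OF coboundaries3_subgroup[OF G]])
  show ?thesis using rcos_sum[OF F] by (simp add: H3_def H3_class_def)
qed

lemma H3_class_mult_coboundary:
  assumes G: "group G" and F: "F \<in> carrier (cocycles3 G)" and g: "g \<in> carrier (cochains2 G)"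
  shows "H3_class G (F \<otimes>\<^bsub>cocycles3 G\<^esub> coboundary2 G g) = H3_class G F"
proof -
  interpret C: comm_group "cocycles3 G" by (rule cocycles3_comm_group[OF G])
  interpret B: subgroup "coboundaries3 G" "cocycles3 G" by (rule coboundaries3_subgroup[OF G])
  have b: "coboundary2 G g \<in> coboundaries3 G" using g by (auto simp: coboundaries3_def)
  then have "F \<otimes>\<^bsub>cocycles3 G\<^esub> coboundary2 G g = coboundary2 G g \<otimes>\<^bsub>cocycles3 G\<^esub> F"
    using F by (intro C.m_comm) auto
  moreover have "coboundaries3 G #>\<^bsub>cocycles3 G\<^esub> (coboundary2 G g \<otimes>\<^bsub>cocycles3 G\<^esub> F) =
      coboundaries3 G #>\<^bsub>cocycles3 G\<^esub> F"
    using C.coset_mult_assoc[OF B.subset _ F, of "coboundary2 G g"] b B.rcos_const[OF C.is_group b]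
    by simp
  ultimately show ?thesis by (simp add: H3_class_def)
qed

text \<open>To evaluate \<open>the_elem\<close> it is enough to exhibit an extensional
  \<open>R\<close> on the quotient that pulls back to \<open>F\<close>: then \<open>F\<close> is
  constant on each product of cosets, and cosets are nonempty.\<close>

lemma descend3_eq:
  fixes G (structure)
  assumes G: "group G" and N: "subgroup N G"
    and R: "R \<in> extensional (carrier (G Mod N) \<times> carrier (G Mod N) \<times> carrier (G Mod N))"
    and F: "\<And>x y z. x \<in> carrier G \<Longrightarrow> y \<in> carrier G \<Longrightarrow> z \<in> carrier G \<Longrightarrow>
      F (x, y, z) = R (N #>\<^bsub>G\<^esub> x, N #>\<^bsub>G\<^esub> y, N #>\<^bsub>G\<^esub> z)"
  shows "descend3 G N F = R"
proof -
  interpret group G by fact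
  interpret N: subgroup N G by fact
  let ?Q = "carrier (G Mod N)"
  have coset: "x \<in> carrier G" "N #> x = X" if "X \<in> ?Q" "x \<in> X" for x X
  proof -
    obtain y where y: "y \<in> carrier G" "X = N #> y"
      using \<open>X \<in> ?Q\<close> by (auto simp: carrier_FactGroup)
    show "x \<in> carrier G"
      using y \<open>x \<in> X\<close> r_coset_subset_G[OF N.subset y(1)] by blast
    show "N #> x = X"
      using y \<open>x \<in> X\<close> repr_independence[of x N y] N by simp
  qed
  have nonempty: "X \<noteq> {}" if "X \<in> ?Q" for X
    using that rcos_self[OF _ N] by (auto simp: carrier_FactGroup)
  have "the_elem (F ` (X \<times> Y \<times> Z)) = R (X, Y, Z)" if "X \<in> ?Q" "Y \<in> ?Q" "Z \<in> ?Q" for X Y Z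
  proof -
    have const: "F p = R (X, Y, Z)" if "p \<in> X \<times> Y \<times> Z" for p
      using that coset \<open>X \<in> ?Q\<close> \<open>Y \<in> ?Q\<close> \<open>Z \<in> ?Q\<close> by (auto simp: F)
    have "F ` (X \<times> Y \<times> Z) = (\<lambda>_. R (X, Y, Z)) ` (X \<times> Y \<times> Z)"
      by (rule image_cong[OF refl const])
    also have "\<dots> = {R (X, Y, Z)}" using nonempty that by (simp add: image_constant_conv)
    finally show ?thesis by simp
  qed
  then show ?thesis
    by (intro extensionalityI[OF _ R]) (auto simp: descend3_def)
qed

text \<open>Evaluate \<open>h\<close> on chosen representatives; invariance under \<open>N\<close>
  in each argument makes the choice harmless.\<close>

lemma quotient_cochain2:
  fixes G (structure)
  assumes G: "comm_group G" and N: "subgroup N G"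
    and norm: "\<And>x y. x \<in> carrier G \<Longrightarrow> y \<in> carrier G \<Longrightarrow> cmod (h x y) = 1"
    and left: "\<And>x y a. x \<in> carrier G \<Longrightarrow> y \<in> carrier G \<Longrightarrow> a \<in> N \<Longrightarrow> h (x \<otimes>\<^bsub>G\<^esub> a) y = h x y"
    and right: "\<And>x y a. x \<in> carrier G \<Longrightarrow> y \<in> carrier G \<Longrightarrow> a \<in> N \<Longrightarrow> h x (y \<otimes>\<^bsub>G\<^esub> a) = h x y"
  obtains g where "g \<in> carrier (cochains2 (G Mod N))"
    "\<And>x y. x \<in> carrier G \<Longrightarrow> y \<in> carrier G \<Longrightarrow> g (N #>\<^bsub>G\<^esub> x, N #>\<^bsub>G\<^esub> y) = h x y"
proof -
  interpret comm_group G by fact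
  interpret N: subgroup N G by fact
  let ?Q = "carrier (G Mod N)"
  define g where "g = (\<lambda>(X, Y)\<in>?Q \<times> ?Q. h (SOME x. x \<in> X) (SOME y. y \<in> Y))"
  \<comment> \<open>Right cosets put the element of \<open>N\<close> on the left; commutativity
    moves it to the side on which \<open>left\<close> and \<open>right\<close> expect it.\<close>
  have rep: "\<exists>a\<in>N. (SOME y. y \<in> N #> x) = x \<otimes> a" if x: "x \<in> carrier G" for x
  proof -
    have "(SOME y. y \<in> N #> x) \<in> N #> x" using rcos_self[OF x N] by (rule someI)
    then obtain a where "a \<in> N" "(SOME y. y \<in> N #> x) = a \<otimes> x" by (auto simp: r_coset_def)
    then show ?thesis using x by (auto simp: m_comm)
  qed
  have g: "g (N #> x, N #> y) = h x y" if xy: "x \<in> carrier G" "y \<in> carrier G" for x y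
  proof -
    obtain a b where "a \<in> N" "b \<in> N" "(SOME y. y \<in> N #> x) = x \<otimes> a" "(SOME z. z \<in> N #> y) = y \<otimes> b"
      using rep xy by metis
    moreover have "N #> x \<in> ?Q" "N #> y \<in> ?Q" using xy by (auto simp: carrier_FactGroup)
    ultimately show ?thesis using xy by (simp add: g_def left right)
  qed
  moreover have "g \<in> carrier (cochains2 (G Mod N))"
  proof -
    have "cmod (g (X, Y)) = 1" if "X \<in> ?Q" "Y \<in> ?Q" for X Y
      using that g norm by (auto simp: carrier_FactGroup)
    then show ?thesis by (simp add: cochains2_iff) (simp add: g_def)
  qed
  ultimately show thesis using that by blast
qed

section \<open>The map \<open>\<Theta>\<close>\<close>

text \<open>Cosets only provide residues, whereas weights carry integer degrees. Passing to the
  residue removes the same integer from \<open>(a + b) div n\<close> as from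
  \<open>a div n + b div n\<close>.\<close>

lemma omega_mod: "omega n (a mod int n) (b mod int n) = omega n a b"
proof (cases "n = 0")
  case False
  have "a + b = (a mod int n + b mod int n) + (a div int n + b div int n) * int n"
    by (simp add: algebra_simps)
  then have "(a + b) div int n = ((a mod int n + b mod int n) + (a div int n + b div int n) * int n) div int n"
    by (rule arg_cong)
  also have "\<dots> = (a mod int n + b mod int n) div int n + (a div int n + b div int n)"
    using False by (subst div_mult_self1) auto
  finally show ?thesis by (simp add: omega_def)
qed (simp add: omega_def)

lemma powi_mult_mod:
  fixes z :: complex
  assumes "z ^ n = 1" "n > 0"
  shows "z powi (a * (b mod int n)) = z powi (a * b)"
proof -
  have z0: "z \<noteq> 0" using assms by (auto simp: power_0_left)
  have "z powi (a * b) = z powi (a * (b mod int n) + int n * (a * (b div int n)))"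
    by (rule arg_cong[where f = "\<lambda>e. z powi e"]) (simp add: algebra_simps flip: distrib_left)
  also have "\<dots> = z powi (a * (b mod int n)) * (z powi int n) powi (a * (b div int n))"
    using z0 by (simp add: power_int_add power_int_mult)
  finally show ?thesis using assms by simp
qed

lemma prod_powi: "(\<Prod>i\<in>I. f i) powi e = (\<Prod>i\<in>I. f i powi e)" for f :: "'i \<Rightarrow> complex"
  by (induction I rule: infinite_finite_induct) (simp_all add: power_int_mult_distrib)

lemma prod_root_of_unity:
  fixes \<zeta> :: "'i \<Rightarrow> complex"
  assumes "\<And>i. i \<in> I \<Longrightarrow> \<zeta> i ^ n = 1"
  shows "(\<Prod>i\<in>I. \<zeta> i powi e i) ^ n = 1"
proof -
  have "(\<zeta> i powi e i) ^ n = 1" if "i \<in> I" for i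
  proof -
    have "(\<zeta> i powi e i) ^ n = \<zeta> i powi (int n * e i)" by (simp add: power_int_power' mult.commute)
    also have "\<dots> = (\<zeta> i ^ n) powi e i" by (simp add: power_int_power)
    finally show ?thesis using assms[OF that] by simp
  qed
  then show ?thesis by (simp add: prod_power_distrib)
qed

text \<open>The representative inside \<open>H3_of_root\<close>, named so that the cocycle condition
  and products can be stated for it.\<close>

definition omega_cochain :: "nat \<Rightarrow> complex \<Rightarrow>
    ((nat \<Rightarrow> complex) \<Rightarrow> complex) set \<times> ((nat \<Rightarrow> complex) \<Rightarrow> complex) set \<times>
      ((nat \<Rightarrow> complex) \<Rightarrow> complex) set \<Rightarrow> complex"
  where "omega_cochain n \<zeta> = (\<lambda>(X, Y, Z)\<in>carrier (PQ n) \<times> carrier (PQ n) \<times> carrier (PQ n).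
      \<zeta> powi (omega n (coset_degree n X) (coset_degree n Y) * coset_degree n Z))"

abbreviation proj :: "nat \<Rightarrow> ((nat \<Rightarrow> complex) \<Rightarrow> complex) \<Rightarrow> ((nat \<Rightarrow> complex) \<Rightarrow> complex) set"
  where "proj n l \<equiv> root_lattice n #>\<^bsub>weight_lattice n\<^esub> l"

section \<open>The quotient \<open>P/Q\<close> and the classes attached to roots of unity\<close>

context
  fixes n :: nat
  assumes n: "n \<ge> 2"
begin

interpretation P: comm_group "weight_lattice n" by (rule weight_lattice_comm_group[OF n])
interpretation Q: subgroup "root_lattice n" "weight_lattice n" by (rule root_lattice_subgroup[OF n])
interpretation Q: normal "root_lattice n" "weight_lattice n"
  by (rule P.subgroup_imp_normal[OF root_lattice_subgroup[OF n]])

lemma PQ_group: "group (PQ n)" by (rule Q.factorgroup_is_group)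

lemma carrier_PQ: "X \<in> carrier (PQ n) \<longleftrightarrow> (\<exists>l\<in>carrier (weight_lattice n). X = proj n l)"
  by (auto simp: carrier_FactGroup)

lemma proj_mult:
  assumes "l \<in> carrier (weight_lattice n)" "m \<in> carrier (weight_lattice n)"
  shows "proj n l \<otimes>\<^bsub>PQ n\<^esub> proj n m = proj n (l \<otimes>\<^bsub>weight_lattice n\<^esub> m)"
  using Q.rcos_sum[OF assms] by simp

lemma omega_cochain_proj:
  assumes z: "\<zeta> ^ n = 1" and lmv: "l \<in> carrier (weight_lattice n)" "m \<in> carrier (weight_lattice n)"
    "v \<in> carrier (weight_lattice n)"
  shows "omega_cochain n \<zeta> (proj n l, proj n m, proj n v) =
    \<zeta> powi (omega n (weight_degree n l) (weight_degree n m) * weight_degree n v)"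
proof -
  have "proj n l \<in> carrier (PQ n)" "proj n m \<in> carrier (PQ n)" "proj n v \<in> carrier (PQ n)"
    using lmv by (auto simp: carrier_PQ)
  then show ?thesis using n z lmv
    by (simp add: omega_cochain_def coset_degree_coset omega_mod powi_mult_mod)
qed

lemma omega_cochain_cocycle:
  assumes z: "\<zeta> ^ n = 1" shows "omega_cochain n \<zeta> \<in> carrier (cocycles3 (PQ n))"
proof -
  have z1: "cmod \<zeta> = 1" using root_of_unity_norm[OF z n] .
  then have z0: "\<zeta> \<noteq> 0" by auto
  have "omega_cochain n \<zeta> \<in> carrier (cochains3 (PQ n))"
    unfolding cochains3_iff using z1 by (auto simp: omega_cochain_def cmod_powi)
  moreover have "omega_cochain n \<zeta> (Y, Z, W) * inverse (omega_cochain n \<zeta> (X \<otimes>\<^bsub>PQ n\<^esub> Y, Z, W))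
      * omega_cochain n \<zeta> (X, Y \<otimes>\<^bsub>PQ n\<^esub> Z, W) * inverse (omega_cochain n \<zeta> (X, Y, Z \<otimes>\<^bsub>PQ n\<^esub> W))
      * omega_cochain n \<zeta> (X, Y, Z) = 1"
    if XYZW: "X \<in> carrier (PQ n)" "Y \<in> carrier (PQ n)" "Z \<in> carrier (PQ n)" "W \<in> carrier (PQ n)" for X Y Z W
  proof -
    obtain x y z w where [simp]: "X = proj n x" "Y = proj n y" "Z = proj n z" "W = proj n w"
      and [simp]: "x \<in> carrier (weight_lattice n)" "y \<in> carrier (weight_lattice n)"
        "z \<in> carrier (weight_lattice n)" "w \<in> carrier (weight_lattice n)"
      using XYZW unfolding carrier_PQ by blast
    let ?d = "weight_degree n"
    \<comment> \<open>The factor of \<open>?d w\<close> vanishes since \<open>omega\<close>, an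
      additivity defect, satisfies the 2-cocycle identity; the two terms in \<open>?d z\<close>
      cancel.\<close>
    have "omega n (?d y) (?d z) * ?d w - omega n (?d x + ?d y) (?d z) * ?d w
        + omega n (?d x) (?d y + ?d z) * ?d w - omega n (?d x) (?d y) * (?d z + ?d w)
        + omega n (?d x) (?d y) * ?d z = 0"
      by (simp add: omega_def algebra_simps)
    then have "\<zeta> powi (omega n (?d y) (?d z) * ?d w - omega n (?d x + ?d y) (?d z) * ?d w
        + omega n (?d x) (?d y + ?d z) * ?d w - omega n (?d x) (?d y) * (?d z + ?d w)
        + omega n (?d x) (?d y) * ?d z) = 1"
      by (simp only: power_int_0_right)
    then show ?thesis
      using z0 by (simp only: power_int_add power_int_diff divide_inverse proj_mult omega_cochain_proj[OF z]
          P.m_closed weight_degree_mult[OF n] simp_thms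
          \<open>X = _\<close> \<open>Y = _\<close> \<open>Z = _\<close> \<open>W = _\<close> \<open>x \<in> _\<close> \<open>y \<in> _\<close> \<open>z \<in> _\<close> \<open>w \<in> _\<close>)
  qed
  ultimately show ?thesis unfolding cocycles3_iff by blast
qed

lemma H3_of_root_eq: "H3_of_root n \<zeta> = H3_class (PQ n) (omega_cochain n \<zeta>)"
  by (simp add: H3_of_root_def omega_cochain_def)

lemma H3_of_root_in: "\<zeta> ^ n = 1 \<Longrightarrow> H3_of_root n \<zeta> \<in> carrier (H3 (PQ n))"
  by (simp add: H3_of_root_eq H3_class_in omega_cochain_cocycle)

lemma H3_of_root_mult:
  assumes "\<zeta> ^ n = 1" "\<xi> ^ n = 1"
  shows "H3_of_root n \<zeta> \<otimes>\<^bsub>H3 (PQ n)\<^esub> H3_of_root n \<xi> = H3_of_root n (\<zeta> * \<xi>)"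
proof -
  have "omega_cochain n \<zeta> \<otimes>\<^bsub>cocycles3 (PQ n)\<^esub> omega_cochain n \<xi> = omega_cochain n (\<zeta> * \<xi>)"
    by (rule ext) (simp add: cocycles3_simps omega_cochain_def power_int_mult_distrib restrict_def split: prod.splits)
  then show ?thesis
    using assms by (simp add: H3_of_root_eq H3_class_mult PQ_group omega_cochain_cocycle)
qed

text \<open>The explicit admissible \<open>f\<close>. Cochains take weights as functions, so the
  exponent vector has to be chosen; \<open>root_coeff\<close> depends only on the entries that are
  unique.\<close>

definition root_cochain :: "(nat \<Rightarrow> complex) \<Rightarrow>
    ((nat \<Rightarrow> complex) \<Rightarrow> complex) \<times> ((nat \<Rightarrow> complex) \<Rightarrow> complex) \<Rightarrow> complex"
  where "root_cochain \<zeta> = (\<lambda>(l, m)\<in>carrier (weight_lattice n) \<times> carrier (weight_lattice n).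
    \<Prod>i=1..n - 1. \<zeta> i powi (root_coeff n i (SOME k. l = weight n k) * weight_degree n m))"

lemma root_cochain_weight:
  assumes "m \<in> carrier (weight_lattice n)"
  shows "root_cochain \<zeta> (weight n k, m) = (\<Prod>i=1..n - 1. \<zeta> i powi (root_coeff n i k * weight_degree n m))"
proof -
  have "weight n k = weight n (SOME j. weight n k = weight n j)"
    using someI[of "\<lambda>j. weight n k = weight n j" k] by simp
  then have "root_coeff n i (SOME j. weight n k = weight n j) = root_coeff n i k" if "i \<in> {1..n - 1}" for i
    using that by (intro root_coeff_cong) (simp_all add: weight_eq_iff)
  then show ?thesis using assms by (simp add: root_cochain_def weight_in)
qed

lemma root_cochain_in:
  assumes "\<And>i. i \<in> {1..n - 1} \<Longrightarrow> \<zeta> i ^ n = 1"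
  shows "root_cochain \<zeta> \<in> carrier (cochains2 (weight_lattice n))"
proof -
  have "cmod (root_cochain \<zeta> (l, m)) = 1"
    if lm: "l \<in> carrier (weight_lattice n)" "m \<in> carrier (weight_lattice n)" for l m
  proof -
    obtain k where k: "l = weight n k" using weight_lattice_weight[OF n lm(1)] by blast
    have "cmod (root_cochain \<zeta> (l, m)) =
        (\<Prod>i=1..n - 1. cmod (\<zeta> i powi (root_coeff n i k * weight_degree n m)))"
      using lm by (simp add: k root_cochain_weight prod_norm)
    also have "\<dots> = 1"
      using assms n by (intro prod.neutral ballI cmod_powi root_of_unity_norm)
    finally show ?thesis .
  qed
  then show ?thesis unfolding cochains2_iff by (auto simp: root_cochain_def)
qed

lemma coboundary_root_cochain:
  assumes z: "\<And>i. i \<in> {1..n - 1} \<Longrightarrow> \<zeta> i ^ n = 1"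
    and lmv: "l \<in> carrier (weight_lattice n)" "m \<in> carrier (weight_lattice n)" "v \<in> carrier (weight_lattice n)"
  shows "coboundary2 (weight_lattice n) (root_cochain \<zeta>) (l, m, v) =
    omega_cochain n (\<Prod>i=1..n - 1. \<zeta> i powi - int i) (proj n l, proj n m, proj n v)"
proof -
  let ?d = "weight_degree n" and ?Z = "\<Prod>i=1..n - 1. \<zeta> i powi - int i"
  have Z: "?Z ^ n = 1" by (rule prod_root_of_unity[OF z])
  obtain k j where k: "l = weight n k" and j: "m = weight n j"
    using weight_lattice_weight[OF n] lmv by metis
  let ?c = "root_coeff n" and ?w = "omega n (?d l) (?d m)"
  have mv: "m \<otimes>\<^bsub>weight_lattice n\<^esub> v \<in> carrier (weight_lattice n)" using lmv by simp
  have "coboundary2 (weight_lattice n) (root_cochain \<zeta>) (l, m, v) =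
      root_cochain \<zeta> (m, v) * inverse (root_cochain \<zeta> (l \<otimes>\<^bsub>weight_lattice n\<^esub> m, v))
      * root_cochain \<zeta> (l, m \<otimes>\<^bsub>weight_lattice n\<^esub> v) * inverse (root_cochain \<zeta> (l, m))"
    using lmv by (simp add: coboundary2_def)
  also have "\<dots> = (\<Prod>i=1..n - 1. \<zeta> i powi (?c i j * ?d v) * inverse (\<zeta> i powi (?c i (\<lambda>i. k i + j i) * ?d v))
      * \<zeta> i powi (?c i k * (?d m + ?d v)) * inverse (\<zeta> i powi (?c i k * ?d m)))"
    using lmv mv unfolding k j weight_mult
    by (simp only: root_cochain_weight weight_degree_mult[OF n] prod.distrib prod_inversef[symmetric] comp_def simp_thms)
  also have "\<dots> = (\<Prod>i=1..n - 1. (\<zeta> i powi - int i) powi (?w * ?d v))"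
  proof (intro prod.cong refl)
    fix i assume i: "i \<in> {1..n - 1}"
    have z0: "\<zeta> i \<noteq> 0" using z[OF i] n by (auto simp: power_0_left)
    \<comment> \<open>The degree is exactly additive, so the terms in \<open>?d m\<close> cancel,
      and the factor of \<open>?d v\<close> is the negative additivity defect of
      \<open>root_coeff\<close>, namely \<open>- int i * ?w\<close>.\<close>
    have "?c i j * ?d v - ?c i (\<lambda>i. k i + j i) * ?d v + ?c i k * (?d m + ?d v) - ?c i k * ?d m
        = - int i * (?w * ?d v)"
      unfolding root_coeff_add k j weight_degree_weight[OF n] by (simp add: algebra_simps)
    then have "\<zeta> i powi (?c i j * ?d v - ?c i (\<lambda>i. k i + j i) * ?d v + ?c i k * (?d m + ?d v) - ?c i k * ?d m)
        = \<zeta> i powi (- int i * (?w * ?d v))"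
      by (rule arg_cong)
    then show "\<zeta> i powi (?c i j * ?d v) * inverse (\<zeta> i powi (?c i (\<lambda>i. k i + j i) * ?d v))
      * \<zeta> i powi (?c i k * (?d m + ?d v)) * inverse (\<zeta> i powi (?c i k * ?d m))
      = (\<zeta> i powi - int i) powi (?w * ?d v)"
      using z0 by (simp only: power_int_add power_int_diff divide_inverse power_int_mult simp_thms)
  qed
  also have "\<dots> = omega_cochain n ?Z (proj n l, proj n m, proj n v)"
    unfolding omega_cochain_proj[OF Z lmv] by (simp only: prod_powi)
  finally show ?thesis .
qed

text \<open>The parameters are inverses because, by \<open>weight_scalar\<close>, the scalar
  \<open>c\<close> pairs with \<open>m\<close> as \<open>inverse c\<close> to the degree of
  \<open>m\<close>. Invariance in the second argument holds since roots have degree divisible by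
  \<open>n\<close>.\<close>

lemma root_cochain_Theta:
  assumes c: "\<And>i. i \<in> {1..n - 1} \<Longrightarrow> \<tau> i = c i \<cdot>\<^sub>m 1\<^sub>m n \<and> c i ^ n = 1"
  shows "root_cochain (\<lambda>i. inverse (c i)) \<in> Theta_cochains n \<tau>"
proof -
  let ?\<zeta> = "\<lambda>i. inverse (c i)"
  have z: "?\<zeta> i ^ n = 1" if "i \<in> {1..n - 1}" for i
    using c[OF that] by (simp add: power_inverse)
  have "root_cochain ?\<zeta> (l, m \<otimes>\<^bsub>weight_lattice n\<^esub> a) = root_cochain ?\<zeta> (l, m)"
    if lma: "l \<in> carrier (weight_lattice n)" "m \<in> carrier (weight_lattice n)" "a \<in> root_lattice n" for l m a
  proof -
    obtain k where k: "l = weight n k" using weight_lattice_weight[OF n lma(1)] by blast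
    have a: "a \<in> carrier (weight_lattice n)" using lma by (simp add: Q.mem_carrier)
    have "weight_degree n (m \<otimes>\<^bsub>weight_lattice n\<^esub> a) mod int n = weight_degree n m mod int n"
      using weight_degree_root_lattice[OF n lma(3)] weight_degree_mult[OF n lma(2) a]
      by (auto elim!: dvdE)
    then have "?\<zeta> i powi (root_coeff n i k * weight_degree n (m \<otimes>\<^bsub>weight_lattice n\<^esub> a)) =
        ?\<zeta> i powi (root_coeff n i k * weight_degree n m)" if "i \<in> {1..n - 1}" for i
      using powi_mult_mod[OF z[OF that]] n by (metis gr0I not_numeral_le_zero)
    then show ?thesis using lma a by (simp add: k root_cochain_weight)
  qed
  moreover have "root_cochain ?\<zeta> (l \<otimes>\<^bsub>weight_lattice n\<^esub> simple_root n j, m) =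
      m (diag_entries n (\<tau> j)) * root_cochain ?\<zeta> (l, m)"
    if lm: "l \<in> carrier (weight_lattice n)" "m \<in> carrier (weight_lattice n)" and j: "j \<in> {1..n - 1}" for l m j
  proof -
    obtain k where k: "l = weight n k" using weight_lattice_weight[OF n lm(1)] by blast
    let ?d = "weight_degree n m"
    have "root_cochain ?\<zeta> (l \<otimes>\<^bsub>weight_lattice n\<^esub> simple_root n j, m) =
        (\<Prod>i=1..n - 1. ?\<zeta> i powi (root_coeff n i (\<lambda>l. k l + root_coord n j l) * ?d))"
      using lm by (simp add: k simple_root_eq[OF n j] weight_mult root_cochain_weight)
    also have "\<dots> = (\<Prod>i=1..n - 1. (if i = j then ?\<zeta> j powi ?d else 1) *
        ?\<zeta> i powi (root_coeff n i k * ?d))"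
    proof (intro prod.cong refl)
      fix i assume i: "i \<in> {1..n - 1}"
      have "?\<zeta> i \<noteq> 0" using z[OF i] n by (auto simp: power_0_left)
      then show "?\<zeta> i powi (root_coeff n i (\<lambda>l. k l + root_coord n j l) * ?d) =
          (if i = j then ?\<zeta> j powi ?d else 1) * ?\<zeta> i powi (root_coeff n i k * ?d)"
        unfolding root_coeff_add_root[OF n i j] by (simp add: distrib_right power_int_add)
    qed
    also have "\<dots> = ?\<zeta> j powi ?d * root_cochain ?\<zeta> (l, m)"
      using j lm by (simp add: prod.distrib k root_cochain_weight)
    also have "?\<zeta> j powi ?d = m (diag_entries n (\<tau> j))"
      using weight_scalar[OF n _ lm(2), of "c j"] c[OF j] by simp
    finally show ?thesis .
  qed
  ultimately show ?thesis
    using root_cochain_in[of ?\<zeta>] z by (simp add: Theta_cochains_def)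
qed

text \<open>Two admissible choices of \<open>f\<close> differ by a cochain that is invariant under the root lattice in
  both arguments, so that their coboundaries differ by a coboundary on the quotient.\<close>

lemma Theta_cochains_class:
  assumes c: "\<And>i. i \<in> {1..n - 1} \<Longrightarrow> \<tau> i = c i \<cdot>\<^sub>m 1\<^sub>m n \<and> c i ^ n = 1"
    and f: "f \<in> Theta_cochains n \<tau>"
  shows "H3_class (PQ n) (descend3 (weight_lattice n) (root_lattice n) (coboundary2 (weight_lattice n) f))
    = H3_of_root n (\<Prod>i=1..n - 1. inverse (c i) powi - int i)"
proof -
  let ?P = "carrier (weight_lattice n)" and ?Z = "\<Prod>i=1..n - 1. inverse (c i) powi - int i"
  have z: "inverse (c i) ^ n = 1" if "i \<in> {1..n - 1}" for i
    using c[OF that] by (simp add: power_inverse)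
  have Z: "?Z ^ n = 1" by (rule prod_root_of_unity[OF z])
  define f0 where "f0 = root_cochain (\<lambda>i. inverse (c i))"
  have f0: "f0 \<in> Theta_cochains n \<tau>" unfolding f0_def by (rule root_cochain_Theta[OF c])
  have norm: "cmod (g (l, m)) = 1"
    and right: "\<And>a. a \<in> root_lattice n \<Longrightarrow> g (l, m \<otimes>\<^bsub>weight_lattice n\<^esub> a) = g (l, m)"
    and left: "\<And>i. i \<in> {1..n - 1} \<Longrightarrow> g (l \<otimes>\<^bsub>weight_lattice n\<^esub> simple_root n i, m) =
      m (diag_entries n (\<tau> i)) * g (l, m)"
    if "g \<in> Theta_cochains n \<tau>" "l \<in> ?P" "m \<in> ?P" for g l m
    using that by (simp_all add: Theta_cochains_def cochains2_iff)
  have nz: "g (l, m) \<noteq> 0" if "g \<in> Theta_cochains n \<tau>" "l \<in> ?P" "m \<in> ?P" for g l m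
    using norm[OF that] by auto
  define h where "h l m = f (l, m) * inverse (f0 (l, m))" for l m
  have root: "simple_root n i \<in> ?P" if "i \<in> {1..n - 1}" for i
    using that by (simp add: simple_root_eq[OF n] weight_in)
  have h_root: "h (l \<otimes>\<^bsub>weight_lattice n\<^esub> simple_root n i) m = h l m"
    if "l \<in> ?P" "m \<in> ?P" "i \<in> {1..n - 1}" for l m i
  proof -
    \<comment> \<open>The transformation rule exhibits this factor in a value of \<open>f\<close>,
      which has modulus 1. So it can be cancelled between \<open>f\<close> and
      \<open>f0\<close>.\<close>
    have "m (diag_entries n (\<tau> i)) \<noteq> 0"
      using left[OF f that] nz[OF f P.m_closed[OF that(1) root[OF that(3)]] that(2)] by auto
    then show ?thesis by (simp add: h_def left[OF f that] left[OF f0 that])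
  qed
  \<comment> \<open>Membership in the weight lattice is carried along so that the product step can
    reassociate and apply the invariance at the shifted point.\<close>
  have h_left: "a \<in> ?P \<and> (\<forall>l\<in>?P. \<forall>m\<in>?P. h (l \<otimes>\<^bsub>weight_lattice n\<^esub> a) m = h l m)"
    if "a \<in> root_lattice n" for a
    using that unfolding root_lattice_def
  proof (induction rule: generate.induct)
    case (incl a)
    then show ?case using root h_root by auto
  next
    case (inv a)
    then obtain i where i: "i \<in> {1..n - 1}" "a = simple_root n i" by blast
    have "h (l \<otimes>\<^bsub>weight_lattice n\<^esub> inv\<^bsub>weight_lattice n\<^esub> a) m = h l m" if "l \<in> ?P" "m \<in> ?P" for l m
      using h_root[of "l \<otimes>\<^bsub>weight_lattice n\<^esub> inv\<^bsub>weight_lattice n\<^esub> a" m i] that root[OF i(1)] i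
      by (simp add: P.m_assoc)
    then show ?case using root i by auto
  next
    case (eng a b)
    then show ?case by (simp add: P.m_assoc[symmetric])
  qed simp
  have h_right: "h l (m \<otimes>\<^bsub>weight_lattice n\<^esub> a) = h l m"
    if "l \<in> ?P" "m \<in> ?P" "a \<in> root_lattice n" for l m a
    using right[OF f that] right[OF f0 that] by (simp add: h_def)
  have h_norm: "cmod (h l m) = 1" if "l \<in> ?P" "m \<in> ?P" for l m
    using norm[OF f that] norm[OF f0 that] by (simp add: h_def norm_mult norm_inverse)
  have "\<exists>g. g \<in> carrier (cochains2 (PQ n)) \<and> (\<forall>l\<in>?P. \<forall>m\<in>?P. g (proj n l, proj n m) = h l m)"
  proof (rule quotient_cochain2[OF weight_lattice_comm_group[OF n] root_lattice_subgroup[OF n], of h])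
    fix g assume "g \<in> carrier (cochains2 (PQ n))"
      and "\<And>l m. l \<in> ?P \<Longrightarrow> m \<in> ?P \<Longrightarrow> g (proj n l, proj n m) = h l m"
    then show ?thesis by (intro exI[of _ g]) simp
  qed (simp_all add: h_norm h_left h_right)
  then obtain g where g: "g \<in> carrier (cochains2 (PQ n))"
    and gh: "\<And>l m. l \<in> ?P \<Longrightarrow> m \<in> ?P \<Longrightarrow> g (proj n l, proj n m) = h l m"
    by blast
  \<comment> \<open>On weights \<open>f\<close> is \<open>f0\<close> times the pullback of
    \<open>g\<close>. Its coboundary is thus that of \<open>f0\<close>, already known, times the
    pullback of a coboundary on the quotient.\<close>
  let ?R = "omega_cochain n ?Z \<otimes>\<^bsub>cocycles3 (PQ n)\<^esub> coboundary2 (PQ n) g"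
  have "descend3 (weight_lattice n) (root_lattice n) (coboundary2 (weight_lattice n) f) = ?R"
  proof (rule descend3_eq[OF P.is_group root_lattice_subgroup[OF n]])
    show "?R \<in> extensional (carrier (PQ n) \<times> carrier (PQ n) \<times> carrier (PQ n))"
      by (simp add: cocycles3_simps)
    fix l m v assume lmv: "l \<in> ?P" "m \<in> ?P" "v \<in> ?P"
    have fh: "f (x, y) = f0 (x, y) * g (proj n x, proj n y)" if "x \<in> ?P" "y \<in> ?P" for x y
      using nz[OF f0 that] by (simp add: gh[OF that] h_def)
    have Q: "proj n l \<in> carrier (PQ n)" "proj n m \<in> carrier (PQ n)" "proj n v \<in> carrier (PQ n)"
      using lmv by (auto simp: carrier_PQ)
    have "coboundary2 (weight_lattice n) f (l, m, v) =
        coboundary2 (weight_lattice n) f0 (l, m, v) * coboundary2 (PQ n) g (proj n l, proj n m, proj n v)"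
      using lmv Q proj_mult[OF lmv(1,2)] proj_mult[OF lmv(2,3)]
      by (simp add: coboundary2_def fh)
    also have "coboundary2 (weight_lattice n) f0 (l, m, v) = omega_cochain n ?Z (proj n l, proj n m, proj n v)"
      unfolding f0_def by (rule coboundary_root_cochain[OF z lmv])
    finally show "coboundary2 (weight_lattice n) f (l, m, v) = ?R (proj n l, proj n m, proj n v)"
      using Q by (simp add: cocycles3_simps)
  qed
  then show ?thesis
    by (simp only: H3_class_mult_coboundary[OF PQ_group omega_cochain_cocycle[OF Z] g] H3_of_root_eq)
qed

section \<open>Evaluation of \<open>Theta\<close> on tuples of scalar matrices, and
  multiplicativity\<close>

lemma Theta_scalar:
  assumes c: "\<And>i. i \<in> {1..n - 1} \<Longrightarrow> \<tau> i = c i \<cdot>\<^sub>m 1\<^sub>m n \<and> c i ^ n = 1"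
  shows "Theta n \<tau> = H3_of_root n (\<Prod>i=1..n - 1. inverse (c i) powi - int i)"
  unfolding Theta_def
proof (rule the_equality)
  show "\<exists>f\<in>Theta_cochains n \<tau>. H3_of_root n (\<Prod>i=1..n - 1. inverse (c i) powi - int i) =
      H3_class (PQ n) (descend3 (weight_lattice n) (root_lattice n) (coboundary2 (weight_lattice n) f))"
    by (rule bexI[OF _ root_cochain_Theta[OF c]])
      (rule Theta_cochains_class[OF c root_cochain_Theta[OF c], symmetric])
next
  fix x
  assume "\<exists>f\<in>Theta_cochains n \<tau>. x =
      H3_class (PQ n) (descend3 (weight_lattice n) (root_lattice n) (coboundary2 (weight_lattice n) f))"
  then obtain f where f: "f \<in> Theta_cochains n \<tau>" and x: "x =
      H3_class (PQ n) (descend3 (weight_lattice n) (root_lattice n) (coboundary2 (weight_lattice n) f))"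
    by blast
  show "x = H3_of_root n (\<Prod>i=1..n - 1. inverse (c i) powi - int i)"
    unfolding x by (rule Theta_cochains_class[OF c f])
qed

lemma center_tuple_scalars:
  assumes "\<tau> \<in> carrier (center_tuples n)"
  obtains c where "\<And>i. i \<in> {1..n - 1} \<Longrightarrow> \<tau> i = c i \<cdot>\<^sub>m 1\<^sub>m n \<and> c i ^ n = 1"
proof -
  have "\<exists>c. \<tau> i = c \<cdot>\<^sub>m 1\<^sub>m n \<and> c ^ n = 1" if i: "i \<in> {1..n - 1}" for i
  proof -
    have "\<tau> i \<in> carrier (group_center (SU n))" using assms i by auto
    then show ?thesis using group_center_SU_scalar[OF n] by metis
  qed
  then show thesis using that by metis
qed

lemma Theta_mult:
  assumes \<tau>: "\<tau> \<in> carrier (center_tuples n)" and \<sigma>: "\<sigma> \<in> carrier (center_tuples n)"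
  shows "Theta n (\<tau> \<otimes>\<^bsub>center_tuples n\<^esub> \<sigma>) = Theta n \<tau> \<otimes>\<^bsub>H3 (PQ n)\<^esub> Theta n \<sigma>"
proof -
  obtain c where c: "\<And>i. i \<in> {1..n - 1} \<Longrightarrow> \<tau> i = c i \<cdot>\<^sub>m 1\<^sub>m n \<and> c i ^ n = 1"
    using center_tuple_scalars[OF \<tau>] by blast
  obtain d where d: "\<And>i. i \<in> {1..n - 1} \<Longrightarrow> \<sigma> i = d i \<cdot>\<^sub>m 1\<^sub>m n \<and> d i ^ n = 1"
    using center_tuple_scalars[OF \<sigma>] by blast
  let ?Z = "\<lambda>c. \<Prod>i=1..n - 1. inverse (c i) powi - int i"
  have Z: "?Z c ^ n = 1" "?Z d ^ n = 1"
    using c d by (intro prod_root_of_unity; simp add: power_inverse)+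
  have "(\<tau> \<otimes>\<^bsub>center_tuples n\<^esub> \<sigma>) i = (c i * d i) \<cdot>\<^sub>m 1\<^sub>m n \<and> (c i * d i) ^ n = 1"
    if "i \<in> {1..n - 1}" for i
  proof -
    have "(c i \<cdot>\<^sub>m 1\<^sub>m n) * (d i \<cdot>\<^sub>m 1\<^sub>m n) = (c i * d i) \<cdot>\<^sub>m (1\<^sub>m n :: complex mat)"
      by (intro eq_matI) (auto simp: mult_smult_assoc_mat[of _ n n _ n] mult_smult_distrib[of _ n n _ n])
    then show ?thesis
      using c[OF that] d[OF that] that by (simp add: group_center_def SU_def power_mult_distrib)
  qed
  then have "Theta n (\<tau> \<otimes>\<^bsub>center_tuples n\<^esub> \<sigma>) = H3_of_root n (?Z (\<lambda>i. c i * d i))"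
    by (rule Theta_scalar)
  also have "?Z (\<lambda>i. c i * d i) = ?Z c * ?Z d"
    by (simp add: prod.distrib power_int_mult_distrib)
  finally have "Theta n (\<tau> \<otimes>\<^bsub>center_tuples n\<^esub> \<sigma>) = H3_of_root n (?Z c * ?Z d)" .
  moreover have "Theta n \<tau> = H3_of_root n (?Z c)" by (rule Theta_scalar[OF c])
  moreover have "Theta n \<sigma> = H3_of_root n (?Z d)" by (rule Theta_scalar[OF d])
  ultimately show ?thesis by (simp only: H3_of_root_mult[OF Z])
qed

lemma Theta_root_of_center:
  assumes \<tau>: "\<tau> \<in> carrier (center_tuples n)"
  shows "Theta n \<tau> = H3_of_root n (\<Prod>i = 1..n - 1. root_of_center n (\<tau> i) powi (- int i))"
    and "Theta n \<tau> \<in> carrier (H3 (PQ n))"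
proof -
  obtain c where c: "\<And>i. i \<in> {1..n - 1} \<Longrightarrow> \<tau> i = c i \<cdot>\<^sub>m 1\<^sub>m n \<and> c i ^ n = 1"
    using center_tuple_scalars[OF \<tau>] by blast
  have "(\<Prod>i = 1..n - 1. root_of_center n (\<tau> i) powi (- int i)) =
      (\<Prod>i=1..n - 1. inverse (c i) powi - int i)"
    by (intro prod.cong refl) (simp add: c root_of_center_scalar[OF n])
  moreover have T: "Theta n \<tau> = H3_of_root n (\<Prod>i=1..n - 1. inverse (c i) powi - int i)"
    by (rule Theta_scalar[OF c])
  ultimately show "Theta n \<tau> = H3_of_root n (\<Prod>i = 1..n - 1. root_of_center n (\<tau> i) powi (- int i))"
    by simp
  have z: "inverse (c i) ^ n = 1" if "i \<in> {1..n - 1}" for i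
    using c[OF that] by (simp add: power_inverse)
  show "Theta n \<tau> \<in> carrier (H3 (PQ n))"
    unfolding T by (rule H3_of_root_in[OF prod_root_of_unity[OF z]])
qed

end

theorem proposition4p1:
  fixes n :: nat
  assumes "n \<ge> 2"
  shows "Theta n \<in> hom (center_tuples n) (H3 (PQ n)) \<and>
    (\<forall>\<tau>\<in>carrier (center_tuples n).
      Theta n \<tau> = H3_of_root n (\<Prod>i = 1..n - 1. root_of_center n (\<tau> i) powi (- int i)))"
  using Theta_root_of_center[OF assms] Theta_mult[OF assms] by (blast intro: homI)

end
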